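(* Let $T$ be a $J$-unitary operator on ${\cal K}$ and $z\in{\mathbb S}^1$. Then $T-z{\bf 1}$ is Fredholm if and only if $1$ is not in the essential spectrum of $V(\overline z\,T)$, equivalently if and only if $\sigma_{\mathrm{ess}}(\Re e\,V(\overline z\,T))<1$ (i.e. every point of this essential spectrum is $<1$). Consequently, $T$ is ${\mathbb S}^1$-Fredholm if and only if $$\max_{z\in{\mathbb S}^1}\sigma_{\mathrm{ess}}\bigl(\Re e\,V(\overline z\,T)\bigr)<1.$$
   Context: ${\cal H}$ is a separable complex Hilbert space, ${\cal K}={\cal H}\oplus{\cal H}$, $J=\begin{pmatrix}{\bf 1}&0\\0&-{\bf 1}\end{pmatrix}$, ${\mathbb S}^1$ the unit circle. A bounded invertible $T=\begin{pmatrix}a&b\\c&d\end{pmatrix}$ on ${\cal K}$ is $J$-unitary if $T^*JT=J$ ($a,d$ are then invertible). For $z\in{\mathbb S}^1$, $V(\overline z\,T)=\begin{pmatrix}\overline z(a^* )^{-1}&bd^{-1}\\-d^{-1}c&z\,d^{-1}\end{pmatrix}$, a unitary, and $\Re e\,V=\tfrac12(V+V^* )$. $T$ is ${\mathbb S}^1$-Fredholm if $T-z{\bf 1}$ is Fredholm for all $z\in{\mathbb S}^1$. The essential spectrum is the spectrum minus the discrete spectrum (isolated eigenvalues of finite multiplicity). *)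

theory Defs
  imports "HOL-Analysis.Analysis"
begin

class complex_hilbert = real_normed_vector + complete_space +
  fixes cscale :: "complex \<Rightarrow> 'a \<Rightarrow> 'a"  (infixr \<open>*\<^sub>C\<close> 75)
    and cinner :: "'a \<Rightarrow> 'a \<Rightarrow> complex"
  assumes cscale_add_right: "a *\<^sub>C (x + y) = a *\<^sub>C x + a *\<^sub>C y"
    and cscale_add_left: "(a + b) *\<^sub>C x = a *\<^sub>C x + b *\<^sub>C x"
    and cscale_cscale: "a *\<^sub>C (b *\<^sub>C x) = (a * b) *\<^sub>C x"
    and cscale_one: "1 *\<^sub>C x = x"
    and scaleR_cscale: "scaleR r x = (complex_of_real r) *\<^sub>C x"
    and cinner_add_right: "cinner x (y + z) = cinner x y + cinner x z"
    and cinner_cscale_right: "cinner x (a *\<^sub>C y) = a * cinner x y"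
    and cinner_commute: "cinner y x = cnj (cinner x y)"
    and cinner_self_norm: "cinner x x = complex_of_real ((norm x)\<^sup>2)"

instantiation prod :: (complex_hilbert, complex_hilbert) complex_hilbert
begin

definition cscale_prod_def: "a *\<^sub>C p = (a *\<^sub>C fst p, a *\<^sub>C snd p)"
definition cinner_prod_def: "cinner p q = cinner (fst p) (fst q) + cinner (snd p) (snd q)"

instance
proof
  fix a b :: complex and x y z :: "'a \<times> 'b" and r :: real
  show "a *\<^sub>C (x + y) = a *\<^sub>C x + a *\<^sub>C y"
    by (simp add: cscale_prod_def cscale_add_right)
  show "(a + b) *\<^sub>C x = a *\<^sub>C x + b *\<^sub>C x"
    by (simp add: cscale_prod_def cscale_add_left)
  show "a *\<^sub>C (b *\<^sub>C x) = (a * b) *\<^sub>C x"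
    by (simp add: cscale_prod_def cscale_cscale)
  show "1 *\<^sub>C x = x"
    by (simp add: cscale_prod_def cscale_one)
  show "scaleR r x = (complex_of_real r) *\<^sub>C x"
    by (simp add: cscale_prod_def scaleR_cscale scaleR_prod_def)
  show "cinner x (y + z) = cinner x y + cinner x z"
    by (simp add: cinner_prod_def cinner_add_right)
  show "cinner x (a *\<^sub>C y) = a * cinner x y"
    by (simp add: cinner_prod_def cscale_prod_def cinner_cscale_right algebra_simps)
  show "cinner y x = cnj (cinner x y)"
    by (simp add: cinner_prod_def cinner_commute[of "fst x"] cinner_commute[of "snd x"])
  show "cinner x x = complex_of_real ((norm x)\<^sup>2)"
    by (simp add: cinner_prod_def cinner_self_norm norm_prod_def)
qed

end

definition clinear :: "('a::complex_hilbert \<Rightarrow> 'b::complex_hilbert) \<Rightarrow> bool" where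
  "clinear f \<longleftrightarrow> (\<forall>x y. f (x + y) = f x + f y) \<and> (\<forall>c x. f (c *\<^sub>C x) = c *\<^sub>C f x)"

definition cbounded :: "('a::complex_hilbert \<Rightarrow> 'b::complex_hilbert) \<Rightarrow> bool" where
  "cbounded f \<longleftrightarrow> clinear f \<and> (\<exists>K. \<forall>x. norm (f x) \<le> K * norm x)"

definition adjoint :: "('a::complex_hilbert \<Rightarrow> 'b::complex_hilbert) \<Rightarrow> ('b \<Rightarrow> 'a)" where
  "adjoint f = (THE g. \<forall>x y. cinner (g x) y = cinner x (f y))"

definition cspan :: "'a::complex_hilbert set \<Rightarrow> 'a set" where
  "cspan S = {x. \<exists>F c. finite F \<and> F \<subseteq> S \<and> x = (\<Sum>v\<in>F. c v *\<^sub>C v)}"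

definition fredholm :: "('a::complex_hilbert \<Rightarrow> 'b::complex_hilbert) \<Rightarrow> bool" where
  "fredholm A \<longleftrightarrow> cbounded A
     \<and> (\<exists>F. finite F \<and> {x. A x = 0} \<subseteq> cspan F)
     \<and> closed (range A)
     \<and> (\<exists>F. finite F \<and> (\<forall>y. \<exists>x. y - A x \<in> cspan F))"

text \<open>Spectrum of a bounded operator: the \<open>\<mu>\<close> with \<open>A - \<mu>1\<close> not invertible
  (by the bounded inverse theorem, bijectivity suffices).\<close>
definition spectrum :: "('a::complex_hilbert \<Rightarrow> 'a) \<Rightarrow> complex set" where
  "spectrum A = {\<mu>. \<not> bij (\<lambda>x. A x - \<mu> *\<^sub>C x)}"

definition discrete_spectrum :: "('a::complex_hilbert \<Rightarrow> 'a) \<Rightarrow> complex set" where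
  "discrete_spectrum A = {\<mu> \<in> spectrum A.
      (\<exists>e>0. ball \<mu> e \<inter> spectrum A = {\<mu>})
    \<and> (\<exists>x. x \<noteq> 0 \<and> A x = \<mu> *\<^sub>C x)
    \<and> (\<exists>F. finite F \<and> {x. A x = \<mu> *\<^sub>C x} \<subseteq> cspan F)}"

definition ess_spectrum :: "('a::complex_hilbert \<Rightarrow> 'a) \<Rightarrow> complex set" where
  "ess_spectrum A = spectrum A - discrete_spectrum A"

definition ReOp :: "('a::complex_hilbert \<Rightarrow> 'a) \<Rightarrow> ('a \<Rightarrow> 'a)" where
  "ReOp A = (\<lambda>x. (1/2) *\<^sub>C (A x + adjoint A x))"

definition Jop :: "'h::complex_hilbert \<times> 'h \<Rightarrow> 'h \<times> 'h" where
  "Jop p = (fst p, - snd p)"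

definition blk_a :: "('h::complex_hilbert \<times> 'h \<Rightarrow> 'h \<times> 'h) \<Rightarrow> 'h \<Rightarrow> 'h" where
  "blk_a T x = fst (T (x, 0))"
definition blk_b :: "('h::complex_hilbert \<times> 'h \<Rightarrow> 'h \<times> 'h) \<Rightarrow> 'h \<Rightarrow> 'h" where
  "blk_b T y = fst (T (0, y))"
definition blk_c :: "('h::complex_hilbert \<times> 'h \<Rightarrow> 'h \<times> 'h) \<Rightarrow> 'h \<Rightarrow> 'h" where
  "blk_c T x = snd (T (x, 0))"
definition blk_d :: "('h::complex_hilbert \<times> 'h \<Rightarrow> 'h \<times> 'h) \<Rightarrow> 'h \<Rightarrow> 'h" where
  "blk_d T y = snd (T (0, y))"

definition J_unitary :: "('h::complex_hilbert \<times> 'h \<Rightarrow> 'h \<times> 'h) \<Rightarrow> bool" where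
  "J_unitary T \<longleftrightarrow> cbounded T \<and> bij T \<and> adjoint T \<circ> Jop \<circ> T = Jop"

text \<open>\<open>V(T) = [[(a\<^sup>*)\<^sup>-\<^sup>1, b d\<^sup>-\<^sup>1], [-d\<^sup>-\<^sup>1 c, d\<^sup>-\<^sup>1]]\<close>; applied to \<open>z\<^sup>- T\<close> this gives
  exactly the matrix \<open>V(z\<^sup>- T)\<close> of the paper.\<close>
definition Vop :: "('h::complex_hilbert \<times> 'h \<Rightarrow> 'h \<times> 'h) \<Rightarrow> ('h \<times> 'h \<Rightarrow> 'h \<times> 'h)" where
  "Vop T = (\<lambda>(x, y).
     (inv (adjoint (blk_a T)) x + blk_b T (inv (blk_d T) y),
      - inv (blk_d T) (blk_c T x) + inv (blk_d T) y))"

definition S1_fredholm :: "('h::complex_hilbert \<times> 'h \<Rightarrow> 'h \<times> 'h) \<Rightarrow> bool" where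
  "S1_fredholm T \<longleftrightarrow> (\<forall>z. cmod z = 1 \<longrightarrow> fredholm (\<lambda>p. T p - z *\<^sub>C p))"

end

theory Submission
  imports Defs
begin

text \<open>
  The equation \<open>T (x, y) = (x', y')\<close> is equivalent to \<open>V (x, y') = (x', y)\<close>. Hence \<open>T - 1\<close> and the normal
  operator \<open>V - 1\<close> have the same kernel, and their ranges correspond under \<open>J\<close>; applied to the rotated
  \<open>cnj z T\<close> this reduces everything to \<open>V - 1\<close>. A normal operator with closed range is bounded below on
  the orthogonal complement of its kernel, by the uniform boundedness principle; so \<open>V - 1\<close> is Fredholm iff
  its kernel is finite-dimensional and it is bounded below off the kernel, which makes \<open>1\<close> at most an isolated point of the
  spectrum of \<open>V\<close> and of \<open>Re V\<close>. Conversely, a spectral gap of the positive operator \<open>2 (1 - Re V)\<close>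
  above \<open>0\<close> bounds its quadratic form \<open>\<parallel>(V - 1) x\<parallel>\<^sup>2\<close> from below off the kernel.

  For uniformity in \<open>z\<close>: an upper bound \<open>m\<close> of the quadratic form of \<open>Re V\<close> on a subspace of finite codimension
  bounds the essential spectrum of \<open>Re V\<close>, and such a bound is stable since \<open>V\<close> is Lipschitz in \<open>z\<close>.
  Compactness of the circle concludes.
\<close>

section \<open>Complex Hilbert spaces\<close>

text \<open>\<open>T - z\<close> need not be normal, so its Fredholm property is not directly a
  statement about spectra; the unitary \<open>V\<close> makes it one. Passing to \<open>Re V\<close>
  loses nothing near \<open>1\<close>: the two points of the circle with a given real part are
  conjugate and equally far from \<open>1\<close>, and no value of the form of \<open>Re V\<close>
  on unit vectors exceeds \<open>1\<close>, so only a gap below \<open>1\<close> has to be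
  controlled.

  The obstacle in the uniform statement is that the kernel of \<open>V - 1\<close> may jump as
  \<open>z\<close> varies, so a lower bound off the kernel does not pass to nearby \<open>z\<close>.
  Orthogonality to a finite set that spans the kernel at one point \<open>w\<close> of the circle is
  a condition that can be kept fixed while \<open>z\<close> moves.\<close>

lemma cscale_zero_left [simp]: "0 *\<^sub>C x = 0"
  using scaleR_cscale[of 0 x] by simp

lemma cscale_zero_right [simp]: "c *\<^sub>C 0 = 0"
  using cscale_add_right[of c 0 0] by simp

lemma cscale_minus_right: "c *\<^sub>C (- x) = - (c *\<^sub>C x)"
  using cscale_add_right[of c x "-x"] by (simp add: eq_neg_iff_add_eq_0 add.commute)

lemma cscale_minus_left: "(- c) *\<^sub>C x = - (c *\<^sub>C x)"
  using cscale_add_left[of c "-c" x] by (simp add: eq_neg_iff_add_eq_0 add.commute)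

lemma cscale_diff_right: "c *\<^sub>C (x - y) = c *\<^sub>C x - c *\<^sub>C y"
  using cscale_add_right[of c x "-y"] by (simp add: cscale_minus_right)

lemma cscale_diff_left: "(a - b) *\<^sub>C x = a *\<^sub>C x - b *\<^sub>C x"
  using cscale_add_left[of a "-b" x] by (simp add: cscale_minus_left)

declare cscale_one [simp] cscale_cscale [simp]

lemma cinner_add_left: "cinner (x + y) z = cinner x z + cinner y z"
  by (metis cinner_add_right cinner_commute complex_cnj_add)

lemma cinner_cscale_left: "cinner (c *\<^sub>C x) y = cnj c * cinner x y"
  by (metis cinner_cscale_right cinner_commute complex_cnj_mult)

lemma cinner_zero_right [simp]: "cinner x 0 = 0"
  using cinner_cscale_right[of x 0 0] by simp

lemma cinner_zero_left [simp]: "cinner 0 x = 0"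
  using cinner_cscale_left[of 0 0 x] by simp

lemma cinner_minus_right: "cinner x (- y) = - cinner x y"
  using cinner_cscale_right[of x "-1" y] by (simp add: cscale_minus_left)

lemma cinner_minus_left: "cinner (- x) y = - cinner x y"
  using cinner_cscale_left[of "-1" x y] by (simp add: cscale_minus_left)

lemma cinner_diff_right: "cinner x (y - z) = cinner x y - cinner x z"
  using cinner_add_right[of x y "-z"] by (simp add: cinner_minus_right)

lemma cinner_diff_left: "cinner (x - y) z = cinner x z - cinner y z"
  using cinner_add_left[of x "-y" z] by (simp add: cinner_minus_left)

lemmas cinner_simps = cinner_add_left cinner_add_right cinner_diff_left cinner_diff_right
  cinner_minus_left cinner_minus_right cinner_cscale_left cinner_cscale_right

lemma cinner_sum_left: "cinner (\<Sum>i\<in>I. f i) y = (\<Sum>i\<in>I. cinner (f i) y)"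
  by (induction I rule: infinite_finite_induct) (auto simp: cinner_add_left)

lemma cinner_eq_zero_commute: "cinner x y = 0 \<longleftrightarrow> cinner y x = 0"
  by (metis cinner_commute complex_cnj_zero)

lemma cinner_self_eq_zero [simp]: "cinner x x = 0 \<longleftrightarrow> x = 0"
  by (simp add: cinner_self_norm)

lemma Re_cinner_self: "Re (cinner x x) = (norm x)\<^sup>2"
  by (simp add: cinner_self_norm)

lemma Re_cinner_commute: "Re (cinner y x) = Re (cinner x y)"
  by (subst cinner_commute) simp

lemma cinner_all_zero: "(\<And>y. cinner y x = 0) \<Longrightarrow> x = 0"
  using cinner_self_eq_zero by blast

lemma cinner_ext: "(\<And>v. cinner x v = cinner y v) \<Longrightarrow> x = y"
  using cinner_self_eq_zero[of "x - y"] by (simp add: cinner_diff_left)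

lemma norm_cscale [simp]: "norm (c *\<^sub>C x) = cmod c * norm x"
proof -
  have "complex_of_real ((norm (c *\<^sub>C x))\<^sup>2) = (cnj c * c) * cinner x x"
    by (simp only: cinner_cscale_left cinner_cscale_right cinner_self_norm[symmetric] mult_ac)
  also have "\<dots> = complex_of_real ((cmod c * norm x)\<^sup>2)"
    by (simp only: cinner_self_norm power_mult_distrib complex_norm_square[of c] of_real_mult mult_ac)
  finally have "(norm (c *\<^sub>C x))\<^sup>2 = (cmod c * norm x)\<^sup>2"
    by (simp only: of_real_eq_iff)
  then show ?thesis
    by (simp add: power2_eq_iff_nonneg)
qed

lemma norm_add_sq: "(norm (x + y))\<^sup>2 = (norm x)\<^sup>2 + (norm y)\<^sup>2 + 2 * Re (cinner x y)"
  for x y :: "'a::complex_hilbert"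
  using Re_cinner_commute[of x y] by (simp add: cinner_simps flip: Re_cinner_self)

lemma norm_diff_sq: "(norm (x - y))\<^sup>2 = (norm x)\<^sup>2 + (norm y)\<^sup>2 - 2 * Re (cinner x y)"
  for x y :: "'a::complex_hilbert"
  using Re_cinner_commute[of x y] by (simp add: cinner_simps flip: Re_cinner_self)

lemma parallelogram:
  "(norm (x + y))\<^sup>2 + (norm (x - y))\<^sup>2 = 2 * (norm x)\<^sup>2 + 2 * (norm y)\<^sup>2" for x y :: "'a::complex_hilbert"
  by (simp add: norm_add_sq norm_diff_sq)

text \<open>Evaluating the quadratic at its minimiser \<open>- b / c\<close> gives the claim; if
  \<open>c = 0\<close>, a linear function bounded below is constant. It serves Cauchy-Schwarz and
  also the orthogonality of a shortest vector to a subspace.\<close>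

lemma discriminant_bound:
  fixes a b c :: real
  assumes "\<And>t. 0 \<le> a + 2 * t * b + t\<^sup>2 * c" "0 \<le> c"
  shows "b\<^sup>2 \<le> a * c"
proof (cases "c = 0")
  case True
  have "b = 0"
  proof (rule ccontr)
    assume "b \<noteq> 0"
    \<comment> \<open>At this \<open>t\<close> the polynomial takes the value
      \<open>-1\<close>.\<close>
    then have "2 * (- (a + 1) / (2 * b)) * b = - (a + 1)" by simp
    with assms(1)[of "- (a + 1) / (2 * b)"] True show False by simp
  qed
  then show ?thesis using True by simp
next
  case False
  then have "c > 0" using assms(2) by simp
  then have "a + 2 * (- b / c) * b + (- b / c)\<^sup>2 * c = (a * c - b\<^sup>2) / c"
    by (simp add: field_simps power2_eq_square)
  with assms(1)[of "- b / c"] have "0 \<le> (a * c - b\<^sup>2) / c" by simp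
  with \<open>c > 0\<close> show ?thesis by (simp add: zero_le_divide_iff)
qed

section \<open>Bounded complex-linear maps and the Cauchy-Schwarz inequality\<close>

lemma clinear_add: "clinear f \<Longrightarrow> f (x + y) = f x + f y"
  and clinear_cscale: "clinear f \<Longrightarrow> f (c *\<^sub>C x) = c *\<^sub>C f x"
  by (auto simp: clinear_def)

lemma clinear_zero: "clinear f \<Longrightarrow> f 0 = 0"
  using clinear_cscale[of f 0 0] by simp

lemma clinear_minus: "clinear f \<Longrightarrow> f (- x) = - f x"
  using clinear_cscale[of f "-1" x] by (simp add: cscale_minus_left)

lemma clinear_diff: "clinear f \<Longrightarrow> f (x - y) = f x - f y"
  using clinear_add[of f x "-y"] by (simp add: clinear_minus)

lemma clinear_scaleR: "clinear f \<Longrightarrow> f (r *\<^sub>R x) = r *\<^sub>R f x"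
  by (simp add: scaleR_cscale clinear_cscale)

lemma cbounded_clinear: "cbounded f \<Longrightarrow> clinear f"
  by (simp add: cbounded_def)

lemma cbounded_pos:
  assumes "cbounded f"
  obtains K where "K > 0" "\<And>x. norm (f x) \<le> K * norm x"
proof -
  obtain K where K: "\<And>x. norm (f x) \<le> K * norm x"
    using assms by (auto simp: cbounded_def)
  have "norm (f x) \<le> (\<bar>K\<bar> + 1) * norm x" for x
    using K[of x] by (rule order_trans) (intro mult_right_mono, auto)
  then show ?thesis using that[of "\<bar>K\<bar> + 1"] by auto
qed

lemma cbounded_bounded_linear: "cbounded f \<Longrightarrow> bounded_linear f"
proof -
  assume f: "cbounded f"
  then obtain K where "\<And>x. norm (f x) \<le> K * norm x" using cbounded_pos by blast
  with f show ?thesis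
    by (intro bounded_linear_intro[where K=K])
      (auto simp: clinear_add clinear_scaleR cbounded_clinear mult.commute)
qed

lemma cbounded_continuous_on: "cbounded f \<Longrightarrow> continuous_on S f"
  by (intro linear_continuous_on cbounded_bounded_linear)

lemma clinear_compose: "clinear f \<Longrightarrow> clinear g \<Longrightarrow> clinear (\<lambda>x. f (g x))"
  by (simp add: clinear_def)

lemma cbounded_compose:
  assumes f: "cbounded f" and g: "cbounded g"
  shows "cbounded (\<lambda>x. f (g x))"
proof -
  obtain K where "K > 0" and K: "\<And>x. norm (f x) \<le> K * norm x" using f cbounded_pos by blast
  obtain L where L: "\<And>x. norm (g x) \<le> L * norm x" using g cbounded_pos by blast
  have "norm (f (g x)) \<le> (K * L) * norm x" for x
    using order_trans[OF K mult_left_mono[OF L]] \<open>K > 0\<close> by (simp add: mult.assoc)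
  then show ?thesis using clinear_compose f g by (auto simp: cbounded_def)
qed

lemma cbounded_add:
  assumes f: "cbounded f" and g: "cbounded g"
  shows "cbounded (\<lambda>x. f x + g x)"
proof -
  obtain K where K: "\<And>x. norm (f x) \<le> K * norm x" using f cbounded_pos by blast
  obtain L where L: "\<And>x. norm (g x) \<le> L * norm x" using g cbounded_pos by blast
  have "norm (f x + g x) \<le> (K + L) * norm x" for x
    using norm_triangle_le[OF add_mono[OF K L]] by (simp add: distrib_right)
  then show ?thesis using f g by (auto simp: cbounded_def clinear_def cscale_add_right)
qed

lemma cbounded_cscale: "cbounded (\<lambda>x. c *\<^sub>C x)"
  by (auto simp: cbounded_def clinear_def cscale_add_right mult.commute[of _ c] intro!: exI[of _ "cmod c"])

lemma cbounded_ident: "cbounded (\<lambda>x. x)"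
  using cbounded_cscale[of 1] by simp

lemma cbounded_diff:
  assumes f: "cbounded f" and g: "cbounded g"
  shows "cbounded (\<lambda>x. f x - g x)"
  using cbounded_add[OF f cbounded_compose[OF cbounded_cscale[of "-1"] g]]
  by (simp add: cscale_minus_left)

lemma cbounded_scaled: "cbounded f \<Longrightarrow> cbounded (\<lambda>x. c *\<^sub>C f x)"
  by (rule cbounded_compose[OF cbounded_cscale])

text \<open>The form is nonnegative along the real line through \<open>x\<close> in direction
  \<open>y\<close>. An arbitrary positive operator is allowed: the identity gives the usual
  inequality, and the pair \<open>x\<close>, \<open>P x\<close> later converts information on norms
  into information on forms.\<close>

lemma positive_form_Cauchy_Schwarz:
  assumes P: "clinear P" and sym: "\<And>x y. cinner (P x) y = cinner x (P y)"
    and pos: "\<And>x. 0 \<le> Re (cinner x (P x))"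
  shows "(Re (cinner x (P y)))\<^sup>2 \<le> Re (cinner x (P x)) * Re (cinner y (P y))"
proof (rule discriminant_bound)
  fix t :: real
  have s: "Re (cinner y (P x)) = Re (cinner x (P y))"
    by (metis Re_cinner_commute sym)
  have "Re (cinner (x + t *\<^sub>R y) (P (x + t *\<^sub>R y)))
      = Re (cinner x (P x)) + 2 * t * Re (cinner x (P y)) + t\<^sup>2 * Re (cinner y (P y))"
    using s by (simp add: scaleR_cscale clinear_add[OF P] clinear_cscale[OF P] cinner_simps
        power2_eq_square algebra_simps)
  with pos[of "x + t *\<^sub>R y"]
  show "0 \<le> Re (cinner x (P x)) + 2 * t * Re (cinner x (P y)) + t\<^sup>2 * Re (cinner y (P y))"
    by simp
qed (rule pos)

lemma Re_cinner_le_norm: "\<bar>Re (cinner x y)\<bar> \<le> norm x * norm y"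
proof -
  have "(Re (cinner x y))\<^sup>2 \<le> (norm x * norm y)\<^sup>2"
    using positive_form_Cauchy_Schwarz[of "\<lambda>x. x" x y]
    by (simp add: clinear_def Re_cinner_self power_mult_distrib)
  then show ?thesis by (simp add: abs_le_square_iff[symmetric])
qed

lemma cmod_cinner_le_norm: "cmod (cinner x y) \<le> norm x * norm y"
proof (cases "cinner x y = 0")
  case False
  \<comment> \<open>A unimodular factor makes the inner product real and nonnegative, so that the
    estimate for real parts applies.\<close>
  define c where "c = cnj (cinner x y) / cmod (cinner x y)"
  have c: "cmod c = 1" using False by (simp add: c_def norm_divide)
  have "cinner x (c *\<^sub>C y) = cmod (cinner x y)"
    using False by (simp add: c_def cinner_cscale_right complex_norm_square[symmetric] field_simps)
      (simp add: power2_eq_square mult.commute[of "cnj _"] flip: complex_norm_square)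
  with Re_cinner_le_norm[of x "c *\<^sub>C y"] c show ?thesis by simp
qed simp

lemma bounded_linear_cinner_right: "bounded_linear (\<lambda>y. cinner x y)"
  by (rule bounded_linear_intro[where K="norm x"])
    (auto simp: cinner_add_right scaleR_cscale cinner_cscale_right scaleR_conv_of_real
      cmod_cinner_le_norm mult.commute[of _ "norm x"])

lemma continuous_on_cinner_right [continuous_intros]:
  "continuous_on S f \<Longrightarrow> continuous_on S (\<lambda>y. cinner x (f y))"
  by (rule bounded_linear.continuous_on[OF bounded_linear_cinner_right])

lemma closed_orthogonal: "closed {x. \<forall>v\<in>M. cinner v x = 0}"
proof -
  have "{x. \<forall>v\<in>M. cinner v x = 0} = (\<Inter>v\<in>M. {x. cinner v x = 0})" by auto
  also have "closed \<dots>"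
    by (intro closed_INT ballI closed_Collect_eq continuous_intros)
  finally show ?thesis .
qed

section \<open>Closed subspaces and orthogonal projection\<close>

definition csubspace :: "'a::complex_hilbert set \<Rightarrow> bool" where
  "csubspace M \<longleftrightarrow> 0 \<in> M \<and> (\<forall>x\<in>M. \<forall>y\<in>M. x + y \<in> M) \<and> (\<forall>c. \<forall>x\<in>M. c *\<^sub>C x \<in> M)"

lemma csubspace_0: "csubspace M \<Longrightarrow> 0 \<in> M"
  and csubspace_add: "csubspace M \<Longrightarrow> x \<in> M \<Longrightarrow> y \<in> M \<Longrightarrow> x + y \<in> M"
  and csubspace_cscale: "csubspace M \<Longrightarrow> x \<in> M \<Longrightarrow> c *\<^sub>C x \<in> M"
  by (auto simp: csubspace_def)

lemma csubspace_diff: "csubspace M \<Longrightarrow> x \<in> M \<Longrightarrow> y \<in> M \<Longrightarrow> x - y \<in> M"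
  using csubspace_add[of M x "(-1) *\<^sub>C y"] csubspace_cscale[of M y "-1"]
  by (simp add: cscale_minus_left)

lemma csubspace_scaleR: "csubspace M \<Longrightarrow> x \<in> M \<Longrightarrow> r *\<^sub>R x \<in> M"
  by (simp add: scaleR_cscale csubspace_cscale)

lemma csubspace_subspace: "csubspace M \<Longrightarrow> subspace M"
  by (simp add: subspace_def csubspace_0 csubspace_add csubspace_scaleR)

lemma csubspace_UNIV: "csubspace UNIV"
  by (simp add: csubspace_def)

lemma csubspace_orthogonal: "csubspace {x. \<forall>v\<in>M. cinner v x = 0}"
  by (simp add: csubspace_def cinner_simps)

lemma csubspace_kernel: "clinear A \<Longrightarrow> csubspace {x. A x = 0}"
  by (simp add: csubspace_def clinear_add clinear_cscale clinear_zero)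

lemma csubspace_image:
  assumes "clinear A" "csubspace M"
  shows "csubspace (A ` M)"
  unfolding csubspace_def
proof (intro conjI ballI allI)
  show "0 \<in> A ` M"
    by (metis assms clinear_zero csubspace_0 image_eqI)
  show "x + y \<in> A ` M" if "x \<in> A ` M" "y \<in> A ` M" for x y
    using that assms by (force simp: clinear_add[symmetric] csubspace_add)
  show "c *\<^sub>C x \<in> A ` M" if "x \<in> A ` M" for x c
    using that assms by (force simp: clinear_cscale[symmetric] csubspace_cscale)
qed

lemma csubspace_closure:
  assumes "csubspace M" shows "csubspace (closure M)"
  unfolding csubspace_def
proof (intro conjI ballI allI)
  show "0 \<in> closure M" using assms closure_subset csubspace_0 by blast
  show "x + y \<in> closure M" if xy: "x \<in> closure M" "y \<in> closure M" for x y
  proof -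
    have "x + y \<in> (\<lambda>(x, y). x + y) ` (closure M \<times> closure M)" using xy by auto
    also have "\<dots> \<subseteq> closure ((\<lambda>(x, y). x + y) ` (M \<times> M))"
      unfolding closure_Times[symmetric]
      by (intro image_closure_subset continuous_intros closure_subset closed_closure)
        (auto simp: case_prod_beta intro!: continuous_intros)
    also have "\<dots> \<subseteq> closure M" using assms by (intro closure_mono) (auto simp: csubspace_add)
    finally show ?thesis .
  qed
  show "c *\<^sub>C x \<in> closure M" if "x \<in> closure M" for x c
  proof -
    have "(\<lambda>x. c *\<^sub>C x) ` closure M \<subseteq> closure M"
      using csubspace_cscale[OF assms] closure_subset[of M]
      by (intro image_closure_subset cbounded_continuous_on cbounded_cscale) auto
    then show ?thesis using that by auto
  qed
qed

lemma projection_exists: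
  assumes M: "csubspace M" and cl: "closed M"
  obtains m where "m \<in> M" "\<And>v. v \<in> M \<Longrightarrow> cinner v (x - m) = 0"
proof -
  define d where "d = (INF m\<in>M. (norm (x - m))\<^sup>2)"
  have bdd: "bdd_below ((\<lambda>m. (norm (x - m))\<^sup>2) ` M)" by (intro bdd_belowI[of _ 0]) auto
  have ne: "M \<noteq> {}" using csubspace_0[OF M] by auto
  have d: "d \<le> (norm (x - m))\<^sup>2" if "m \<in> M" for m
    unfolding d_def by (rule cINF_lower[OF bdd that])
  have "\<exists>m\<in>M. (norm (x - m))\<^sup>2 < d + 1 / Suc n" for n
    using cINF_less_iff[OF ne bdd, of "d + 1 / Suc n"] by (simp add: d_def)
  then obtain f where fM: "\<And>n. f n \<in> M" and f: "\<And>n. (norm (x - f n))\<^sup>2 < d + 1 / Suc n"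
    by metis
  have est: "(norm (f i - f j))\<^sup>2 \<le> 2 / Suc i + 2 / Suc j" for i j
  proof -
    \<comment> \<open>The midpoint lies in \<open>M\<close>, so its squared distance to
      \<open>x\<close> is at least \<open>d\<close>; with the parallelogram law this makes a
      minimising sequence Cauchy.\<close>
    have "(1/2) *\<^sub>R (f i + f j) \<in> M"
      using M fM by (simp add: csubspace_add csubspace_scaleR)
    from d[OF this] have "4 * d \<le> 4 * (norm (x - (1/2) *\<^sub>R (f i + f j)))\<^sup>2" by simp
    also have "\<dots> = (norm (2 *\<^sub>R (x - (1/2) *\<^sub>R (f i + f j))))\<^sup>2"
      by (simp add: power_mult_distrib)
    also have "2 *\<^sub>R (x - (1/2) *\<^sub>R (f i + f j)) = (x - f i) + (x - f j)"
      by (simp add: algebra_simps scaleR_2)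
    finally have "4 * d \<le> (norm ((x - f i) + (x - f j)))\<^sup>2" .
    moreover have "norm ((x - f i) - (x - f j)) = norm (f i - f j)"
      by (simp add: norm_minus_commute)
    ultimately show ?thesis
      using parallelogram[of "x - f i" "x - f j"] f[of i] f[of j]
      by (simp only: divide_inverse)
  qed
  have "Cauchy f"
  proof (rule metric_CauchyI)
    fix e :: real assume "e > 0"
    then obtain n0 where n0: "1 / Suc n0 < e\<^sup>2 / 4"
      using reals_Archimedean[of "e\<^sup>2 / 4"] by (auto simp: inverse_eq_divide)
    have "dist (f i) (f j) < e" if "i \<ge> n0" "j \<ge> n0" for i j
    proof -
      have "1 / real (Suc i) \<le> 1 / real (Suc n0)" "1 / real (Suc j) \<le> 1 / real (Suc n0)"
        using that by (auto intro!: divide_left_mono)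
      with est[of i j] n0 have "(norm (f i - f j))\<^sup>2 < e\<^sup>2" by linarith
      then show ?thesis using \<open>e > 0\<close> by (simp add: dist_norm power2_less_imp_less)
    qed
    then show "\<exists>n0. \<forall>i\<ge>n0. \<forall>j\<ge>n0. dist (f i) (f j) < e" by blast
  qed
  then obtain m where m: "f \<longlonglongrightarrow> m"
    using Cauchy_convergent_iff convergent_def by blast
  have mM: "m \<in> M" using closed_sequentially[OF cl _ m] fM by blast
  have lim1: "(\<lambda>n. (norm (x - f n))\<^sup>2) \<longlonglongrightarrow> (norm (x - m))\<^sup>2"
    by (intro tendsto_intros m)
  have lim2: "(\<lambda>n. d + 1 / Suc n) \<longlonglongrightarrow> d + 0"
    by (intro tendsto_intros lim_1_over_n[THEN LIMSEQ_Suc])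
  have md: "(norm (x - m))\<^sup>2 \<le> d"
    using LIMSEQ_le[OF lim1 lim2] f by (auto intro: less_imp_le)
  have re: "Re (cinner v (x - m)) = 0" if v: "v \<in> M" for v
  proof -
    \<comment> \<open>Moving from \<open>m\<close> along \<open>v\<close> cannot shorten the
      distance to \<open>x\<close>: the change is a nonnegative quadratic in \<open>t\<close> with
      constant term \<open>0\<close>.\<close>
    have "(Re (cinner v (x - m)))\<^sup>2 \<le> 0 * (norm v)\<^sup>2"
    proof (rule discriminant_bound)
      fix t :: real
      have "m - t *\<^sub>R v \<in> M" using M mM v by (simp add: csubspace_diff csubspace_scaleR)
      from order_trans[OF md d[OF this]] have "(norm (x - m))\<^sup>2 \<le> (norm ((x - m) + t *\<^sub>R v))\<^sup>2"
        by (simp only: diff_diff_eq2 diff_add_eq)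
      then show "0 \<le> 0 + 2 * t * Re (cinner v (x - m)) + t\<^sup>2 * (norm v)\<^sup>2"
        using Re_cinner_commute[of v "x - m"]
        by (simp add: norm_add_sq scaleR_cscale cinner_cscale_right power_mult_distrib)
    qed simp
    then show ?thesis by simp
  qed
  \<comment> \<open>Replacing \<open>v\<close> by \<open>\<i> *\<^sub>C v\<close> turns the
    vanishing of real parts into that of imaginary parts.\<close>
  have "cinner v (x - m) = 0" if v: "v \<in> M" for v
    using re[OF v] re[OF csubspace_cscale[OF M v, of \<i>]]
    by (simp add: cinner_cscale_left complex_eq_iff)
  with mM show ?thesis using that by blast
qed

lemma orthogonal_zero_imp_UNIV:
  assumes M: "csubspace M" "closed M" and "\<And>y. (\<And>v. v \<in> M \<Longrightarrow> cinner v y = 0) \<Longrightarrow> y = 0"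
  shows "M = UNIV"
proof -
  have "x \<in> M" for x
  proof -
    obtain m where m: "m \<in> M" "\<And>v. v \<in> M \<Longrightarrow> cinner v (x - m) = 0"
      using projection_exists[OF M] by blast
    then have "x - m = 0" using assms(3) by blast
    with m show ?thesis by simp
  qed
  then show ?thesis by auto
qed

section \<open>Adjoints and uniform boundedness\<close>

lemma adjoint_eqI:
  assumes "\<And>x y. cinner (g x) y = cinner x (f y)"
  shows "adjoint f = g"
  unfolding adjoint_def
proof (rule the_equality)
  show "\<forall>x y. cinner (g x) y = cinner x (f y)" using assms by blast
  show "h = g" if "\<forall>x y. cinner (h x) y = cinner x (f y)" for h
  proof
    show "h x = g x" for x by (rule cinner_ext) (simp add: that assms)
  qed
qed

text \<open>A nonzero functional is a multiple of the pairing with any nonzero vector orthogonal to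
  its kernel; \<open>r\<close> is such a vector, and \<open>w\<close> is its normalisation.\<close>

lemma Riesz_representation:
  assumes f: "cbounded f"
  obtains w where "\<And>y. cinner w y = cinner x (f y)"
proof (cases "\<forall>y. cinner x (f y) = 0")
  case True
  then show ?thesis using that[of 0] by simp
next
  case False
  then obtain u where u: "cinner x (f u) \<noteq> 0" by blast
  have lin: "clinear f" using f by (rule cbounded_clinear)
  let ?N = "{y. cinner x (f y) = 0}"
  have N: "csubspace ?N"
    by (simp add: csubspace_def clinear_zero[OF lin] clinear_add[OF lin] clinear_cscale[OF lin] cinner_simps)
  have clN: "closed ?N"
    by (intro closed_Collect_eq continuous_intros cbounded_continuous_on f)
  obtain m where m: "m \<in> ?N" "\<And>v. v \<in> ?N \<Longrightarrow> cinner v (u - m) = 0"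
    using projection_exists[OF N clN] by blast
  define r where "r = u - m"
  have r: "cinner x (f r) = cinner x (f u)"
    using m by (simp add: r_def clinear_diff[OF lin] cinner_simps)
  then have r0: "r \<noteq> 0" using u clinear_zero[OF lin] by auto
  define w where "w = cnj (cinner x (f r) / cinner r r) *\<^sub>C r"
  have "cinner w y = cinner x (f y)" for y
  proof -
    let ?n = "y - (cinner x (f y) / cinner x (f r)) *\<^sub>C r"
    have "?n \<in> ?N"
      using u r by (simp add: clinear_diff[OF lin] clinear_cscale[OF lin] cinner_simps)
    then have "cinner ?n r = 0" using m(2) r_def by blast
    then have "cinner r ?n = 0" by (simp add: cinner_eq_zero_commute)
    then have "cinner r y = cinner x (f y) / cinner x (f r) * cinner r r"
      by (simp add: cinner_simps)
    then show ?thesis using r u r0 by (simp add: w_def cinner_cscale_left)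
  qed
  then show ?thesis using that by blast
qed

lemma cinner_adjoint_left:
  assumes "cbounded f"
  shows "cinner (adjoint f x) y = cinner x (f y)"
proof -
  have "\<exists>w. \<forall>y. cinner w y = cinner x (f y)" for x
    using Riesz_representation[OF assms] by metis
  then obtain g where "\<And>x y. cinner (g x) y = cinner x (f y)" by metis
  then show ?thesis using adjoint_eqI[of g f] by simp
qed

text \<open>The Baire category theorem applies to the closed sets on which all functionals
  \<open>cinner x\<close> are bounded by the same \<open>n\<close>.\<close>
lemma weakly_bounded_imp_bounded:
  fixes X :: "'a::complex_hilbert set"
  assumes "\<And>u. \<exists>K. \<forall>x\<in>X. cmod (cinner x u) \<le> K"
  obtains K where "\<And>x. x \<in> X \<Longrightarrow> norm x \<le> K"
proof -
  define E where "E n = {u. \<forall>x\<in>X. cmod (cinner x u) \<le> real n}" for n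
  have clE: "closed (E n)" for n
  proof -
    have "E n = (\<Inter>x\<in>X. {u. cmod (cinner x u) \<le> real n})" by (auto simp: E_def)
    also have "closed \<dots>" by (intro closed_INT ballI closed_Collect_le continuous_intros)
    finally show ?thesis .
  qed
  have un: "(\<Union>n. E n) = UNIV"
  proof -
    have "\<exists>n. u \<in> E n" for u
    proof -
      obtain K where K: "\<forall>x\<in>X. cmod (cinner x u) \<le> K" using assms by blast
      obtain n where "K \<le> real n" using real_arch_simple by blast
      with K have "u \<in> E n" by (auto simp: E_def intro: order_trans)
      then show ?thesis ..
    qed
    then show ?thesis by auto
  qed
  have "\<exists>n. interior (E n) \<noteq> {}"
  proof (rule ccontr)
    assume *: "\<nexists>n. interior (E n) \<noteq> {}"
    have "Met_TC.mtopology interior_of \<Union>(range E) = {}"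
    proof (rule Met_TC.metric_Baire_category_alt)
      show "Met_TC.mcomplete TYPE('a)" by (simp add: complete_UNIV)
      show "closedin Met_TC.mtopology S \<and> Met_TC.mtopology interior_of S = {}" if "S \<in> range E" for S
        using that * clE by (auto simp: closed_closedin[symmetric])
    qed auto
    with un show False by simp
  qed
  then obtain n u0 where "u0 \<in> interior (E n)" by blast
  then obtain e where e: "e > 0" "ball u0 e \<subseteq> E n" by (auto simp: mem_interior)
  have "norm x \<le> 4 * real n / e" if x: "x \<in> X" for x
  proof (cases "x = 0")
    case True then show ?thesis using e by simp
  next
    case False
    \<comment> \<open>Half the radius keeps \<open>u0 + w\<close> inside the ball. Pairing
      \<open>x\<close> with the difference of two points of \<open>E n\<close> gives at most
      \<open>2 * n\<close>, whence the constant \<open>4 * n / e\<close>.\<close>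
    define w where "w = (e / 2 / norm x) *\<^sub>R x"
    have nw: "norm w = e / 2" using False e by (simp add: w_def)
    have "u0 + w \<in> E n" "u0 \<in> E n" using e nw by (auto simp: dist_norm subset_iff)
    then have b: "cmod (cinner x (u0 + w)) \<le> n" "cmod (cinner x u0) \<le> n"
      using x by (auto simp: E_def)
    have "cinner x w = complex_of_real (e / 2 * norm x)"
      using False by (simp add: w_def scaleR_cscale cinner_cscale_right cinner_self_norm power2_eq_square)
    then have "e / 2 * norm x = cmod (cinner x w)" using e by (simp only: norm_of_real) simp
    also have "cinner x w = cinner x (u0 + w) - cinner x u0" by (simp add: cinner_add_right)
    also have "cmod \<dots> \<le> 2 * n" using norm_triangle_ineq4[of "cinner x (u0 + w)" "cinner x u0"] b by linarith
    finally show ?thesis using e by (simp add: field_simps)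
  qed
  then show ?thesis using that by blast
qed

section \<open>Finite-dimensional subspaces and normal operators\<close>

lemma cspan_finite_iff:
  assumes "finite F"
  shows "x \<in> cspan F \<longleftrightarrow> (\<exists>c. x = (\<Sum>v\<in>F. c v *\<^sub>C v))"
proof
  assume "x \<in> cspan F"
  then obtain G c where G: "G \<subseteq> F" "x = (\<Sum>v\<in>G. c v *\<^sub>C v)" by (auto simp: cspan_def)
  have "x = (\<Sum>v\<in>F. (if v \<in> G then c v else 0) *\<^sub>C v)"
    unfolding G(2) using G(1) assms by (intro sum.mono_neutral_cong_left) auto
  then show "\<exists>c. x = (\<Sum>v\<in>F. c v *\<^sub>C v)" by (intro exI)
qed (use assms in \<open>auto simp: cspan_def\<close>)

lemma cspan_empty [simp]: "cspan {} = {0}"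
  by (auto simp: cspan_finite_iff)

lemma cspan_insert_iff:
  assumes "finite F"
  shows "x \<in> cspan (insert v F) \<longleftrightarrow> (\<exists>c. x - c *\<^sub>C v \<in> cspan F)"
proof (cases "v \<in> F")
  case True
  have add: "x \<in> cspan F" if "x - c *\<^sub>C v \<in> cspan F" for c
  proof -
    obtain d where "x - c *\<^sub>C v = (\<Sum>w\<in>F. d w *\<^sub>C w)"
      using \<open>x - c *\<^sub>C v \<in> cspan F\<close> unfolding cspan_finite_iff[OF assms] by blast
    moreover have "(\<Sum>w\<in>F. (d(v := d v + c)) w *\<^sub>C w) = (\<Sum>w\<in>F. d w *\<^sub>C w) + c *\<^sub>C v"
      using True assms by (simp add: sum.remove[of F v] cscale_add_left)
    ultimately show ?thesis
      using assms unfolding cspan_finite_iff[OF assms] by (metis diff_add_cancel)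
  qed
  have "x - 0 *\<^sub>C v \<in> cspan F" if "x \<in> cspan F" using that by simp
  with add True show ?thesis by (metis insert_absorb)
next
  case False
  have "(\<Sum>w\<in>F. (d(v := c)) w *\<^sub>C w) = (\<Sum>w\<in>F. d w *\<^sub>C w)" for c d
    using False by (intro sum.cong) auto
  then have *: "(\<Sum>w\<in>insert v F. (d(v := c)) w *\<^sub>C w) = c *\<^sub>C v + (\<Sum>w\<in>F. d w *\<^sub>C w)" for c d
    using False assms by simp
  have **: "(\<exists>d'. x = (\<Sum>w\<in>insert v F. d' w *\<^sub>C w)) \<longleftrightarrow> (\<exists>c d. x = c *\<^sub>C v + (\<Sum>w\<in>F. d w *\<^sub>C w))"
  proof safe
    show "\<exists>c d. (\<Sum>w\<in>insert v F. d' w *\<^sub>C w) = c *\<^sub>C v + (\<Sum>w\<in>F. d w *\<^sub>C w)" for d'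
      using False assms by (intro exI[of _ "d' v"] exI[of _ d']) simp
    show "\<exists>d'. c *\<^sub>C v + (\<Sum>w\<in>F. d w *\<^sub>C w) = (\<Sum>w\<in>insert v F. d' w *\<^sub>C w)" for c d
      using *[of d c] by (intro exI[of _ "d(v := c)"]) simp
  qed
  have "finite (insert v F)" using assms by simp
  from cspan_finite_iff[OF this, of x] show ?thesis
    unfolding ** cspan_finite_iff[OF assms] by (simp add: diff_eq_eq add.commute)
qed

lemma cspan_superset: "F \<subseteq> cspan F"
proof
  fix v assume "v \<in> F"
  then show "v \<in> cspan F"
    unfolding cspan_def by (auto intro!: exI[of _ "{v}"] exI[of _ "\<lambda>_. 1"])
qed

lemma orthogonal_cspan:
  assumes "\<And>v. v \<in> F \<Longrightarrow> cinner v x = 0" "w \<in> cspan F"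
  shows "cinner w x = 0"
proof -
  obtain G c where "G \<subseteq> F" "w = (\<Sum>v\<in>G. c v *\<^sub>C v)" using assms(2) by (auto simp: cspan_def)
  then show ?thesis
    using assms(1) by (auto simp: cinner_sum_left cinner_cscale_left intro!: sum.neutral)
qed

lemma clinear_cspan:
  assumes A: "clinear A" and "finite F" "x \<in> cspan F"
  shows "A x \<in> cspan (A ` F)"
  using assms(2,3)
proof (induction F arbitrary: x)
  case empty
  then show ?case by (simp add: clinear_zero[OF A])
next
  case (insert v F)
  then obtain c where "x - c *\<^sub>C v \<in> cspan F" by (auto simp: cspan_insert_iff)
  from insert.IH[OF this] have "A x - c *\<^sub>C A v \<in> cspan (A ` F)"
    by (simp add: clinear_diff[OF A] clinear_cscale[OF A])
  then show ?case using insert.hyps by (auto simp: cspan_insert_iff)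
qed

text \<open>Replacing \<open>v\<close> by its component \<open>u\<close> orthogonal to
  \<open>M\<close> leaves the sum with \<open>M\<close> unchanged and makes the coefficient a
  continuous function of \<open>x\<close>; the sum is then a preimage of \<open>M\<close>.\<close>

lemma closed_add_line:
  assumes M: "csubspace M" "closed M"
  shows "csubspace {x. \<exists>c. x - c *\<^sub>C v \<in> M}" and "closed {x. \<exists>c. x - c *\<^sub>C v \<in> M}"
proof -
  let ?M = "{x. \<exists>c. x - c *\<^sub>C v \<in> M}"
  show "csubspace ?M"
    unfolding csubspace_def
  proof (intro conjI ballI allI)
    show "0 \<in> ?M" using csubspace_0[OF M(1)] by (auto intro!: exI[of _ 0])
    show "x + y \<in> ?M" if xy: "x \<in> ?M" "y \<in> ?M" for x y
    proof -
      obtain c d where "x - c *\<^sub>C v \<in> M" "y - d *\<^sub>C v \<in> M" using xy by auto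
      from csubspace_add[OF M(1) this] show ?thesis
        by (auto intro!: exI[of _ "c + d"] simp: cscale_add_left algebra_simps)
    qed
    show "a *\<^sub>C x \<in> ?M" if x: "x \<in> ?M" for x a
    proof -
      obtain c where "x - c *\<^sub>C v \<in> M" using x by auto
      from csubspace_cscale[OF M(1) this, of a] show ?thesis
        by (auto intro!: exI[of _ "a * c"] simp: cscale_diff_right)
    qed
  qed
  obtain m where m: "m \<in> M" "\<And>w. w \<in> M \<Longrightarrow> cinner w (v - m) = 0"
    using projection_exists[OF M] by blast
  define u where "u = v - m"
  have uM: "cinner u w = 0" if "w \<in> M" for w
    using m(2)[OF that] by (simp add: u_def cinner_eq_zero_commute)
  \<comment> \<open>If \<open>v\<close> lies in \<open>M\<close>, then \<open>u = 0\<close> and the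
    quotient is \<open>0\<close> by convention; the subtracted term vanishes in any case.\<close>
  have "\<exists>c. x - c *\<^sub>C v \<in> M \<Longrightarrow> x - (cinner u x / cinner u u) *\<^sub>C u \<in> M" for x
  proof -
    assume "\<exists>c. x - c *\<^sub>C v \<in> M"
    then obtain c where c: "x - c *\<^sub>C v \<in> M" by blast
    have x: "x = (x - c *\<^sub>C v) + c *\<^sub>C m + c *\<^sub>C u" by (simp add: u_def cscale_diff_right)
    have xu: "x - c *\<^sub>C u \<in> M"
      using csubspace_add[OF M(1) c csubspace_cscale[OF M(1) m(1), of c]] x
      by (metis add_diff_cancel_right')
    from uM[OF this] have "cinner u x = c * cinner u u" by (simp add: cinner_simps)
    with xu show ?thesis by (cases "u = 0") auto
  qed
  moreover have "x - d *\<^sub>C v \<in> M" if "x - d *\<^sub>C u \<in> M" for x d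
    using csubspace_diff[OF M(1) that csubspace_cscale[OF M(1) m(1), of d]]
    by (simp add: u_def cscale_diff_right)
  ultimately have "?M = {x. x - (cinner u x / cinner u u) *\<^sub>C u \<in> M}" by blast
  also have "closed \<dots>"
  proof -
    have "continuous_on UNIV (\<lambda>x. cinner u x *\<^sub>C ((1 / cinner u u) *\<^sub>C u))"
    proof (rule linear_continuous_on, rule bounded_linear_intro)
      show "norm (cinner u x *\<^sub>C ((1 / cinner u u) *\<^sub>C u)) \<le> norm x * (norm u * norm ((1 / cinner u u) *\<^sub>C u))" for x
        using mult_right_mono[OF cmod_cinner_le_norm[of u x], of "norm ((1 / cinner u u) *\<^sub>C u)"]
        by (simp only: norm_cscale mult_ac) simp
    qed (simp_all add: cinner_add_right cscale_add_left add_divide_distrib scaleR_cscale cinner_cscale_right)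
    then have "continuous_on UNIV (\<lambda>x. x - (cinner u x / cinner u u) *\<^sub>C u)"
      by (intro continuous_intros) simp
    from continuous_closed_preimage[OF this closed_UNIV M(2)] show ?thesis by (simp add: vimage_def)
  qed
  finally show "closed ?M" .
qed

text \<open>One generator after the other is absorbed into \<open>M\<close>, which therefore varies
  in the induction.\<close>

lemma closed_add_cspan:
  assumes "finite F" "csubspace M" "closed M"
  shows "csubspace {x. \<exists>m\<in>M. x - m \<in> cspan F} \<and> closed {x. \<exists>m\<in>M. x - m \<in> cspan F}"
  using assms
proof (induction F arbitrary: M)
  case empty
  then show ?case by (simp add: Bex_def)
next
  case (insert v F)
  let ?M = "{x. \<exists>c. x - c *\<^sub>C v \<in> M}"
  have "{x. \<exists>m\<in>M. x - m \<in> cspan (insert v F)} = {x. \<exists>m\<in>?M. x - m \<in> cspan F}"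
  proof (intro set_eqI iffI; clarsimp simp: cspan_insert_iff[OF insert.hyps(1)])
    show "\<exists>m. (\<exists>c. m - c *\<^sub>C v \<in> M) \<and> x - m \<in> cspan F"
      if "m \<in> M" "x - m - c *\<^sub>C v \<in> cspan F" for x m c
      using that by (intro exI[of _ "m + c *\<^sub>C v"]) (auto simp: diff_diff_eq intro!: exI[of _ c])
    show "\<exists>m\<in>M. \<exists>c. x - m - c *\<^sub>C v \<in> cspan F"
      if "m - c *\<^sub>C v \<in> M" "x - m \<in> cspan F" for x m c
      using that by (intro bexI[of _ "m - c *\<^sub>C v"] exI[of _ c]) auto
  qed
  then show ?case
    using insert.IH[OF closed_add_line[OF insert.prems]] by simp
qed

lemma cspan_closed:
  assumes "finite F" shows "csubspace (cspan F)" "closed (cspan F)"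
  using closed_add_cspan[OF assms, of "{0}"] by (auto simp: csubspace_def)

text \<open>The functionals given by \<open>F\<close> separate the points of \<open>K\<close>, which
  bounds its dimension: passing to the kernel of one functional costs at most one spanning
  vector.\<close>

lemma csubspace_in_cspan:
  assumes "finite F" "csubspace K" "\<And>x. x \<in> K \<Longrightarrow> (\<And>v. v \<in> F \<Longrightarrow> cinner v x = 0) \<Longrightarrow> x = 0"
  shows "\<exists>F'. finite F' \<and> K \<subseteq> cspan F'"
  using assms
proof (induction F arbitrary: K)
  case empty
  then show ?case by (intro exI[of _ "{}"]) auto
next
  case (insert v F)
  let ?K = "{x \<in> K. cinner v x = 0}"
  have "csubspace ?K" using insert.prems(1) by (simp add: csubspace_def cinner_simps)
  moreover have "x = 0" if "x \<in> ?K" "\<And>v. v \<in> F \<Longrightarrow> cinner v x = 0" for x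
    using that insert.prems(2)[of x] by auto
  ultimately obtain F' where F': "finite F'" "?K \<subseteq> cspan F'" using insert.IH by blast
  show ?case
  proof (cases "K \<subseteq> ?K")
    case True
    then show ?thesis using F' by blast
  next
    case False
    then obtain k where k: "k \<in> K" "cinner v k \<noteq> 0" by auto
    have "x \<in> cspan (insert k F')" if "x \<in> K" for x
    proof -
      have "x - (cinner v x / cinner v k) *\<^sub>C k \<in> ?K"
        using that k insert.prems(1) by (simp add: csubspace_diff csubspace_cscale cinner_simps)
      then show ?thesis using F' by (auto simp: cspan_insert_iff)
    qed
    then show ?thesis using F' by (intro exI[of _ "insert k F'"]) auto
  qed
qed

text \<open>The adjoint is carried as an explicit operator, fixed by its pairing with
  \<open>A\<close>, so that shifts and inverses of unitaries supply it directly.\<close>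

definition normal_pair :: "('a::complex_hilbert \<Rightarrow> 'a) \<Rightarrow> ('a \<Rightarrow> 'a) \<Rightarrow> bool" where
  "normal_pair A B \<longleftrightarrow> cbounded A \<and> cbounded B
     \<and> (\<forall>x y. cinner (B x) y = cinner x (A y)) \<and> (\<forall>x. A (B x) = B (A x))"

lemma normal_pairD:
  assumes "normal_pair A B"
  shows "cbounded A" "cbounded B" "clinear A" "clinear B" "cinner (B x) y = cinner x (A y)"
    "A (B x) = B (A x)"
  using assms by (auto simp: normal_pair_def cbounded_clinear)

lemma normal_pair_cinner: "normal_pair A B \<Longrightarrow> cinner (A x) y = cinner x (B y)"
  by (metis cinner_commute normal_pairD(5))

lemma normal_pair_norm: "normal_pair A B \<Longrightarrow> norm (B x) = norm (A x)"
proof -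
  assume N: "normal_pair A B"
  have "cinner (B x) (B x) = cinner (A x) (A x)"
    using normal_pairD(5)[OF N, of x "B x"] normal_pair_cinner[OF N, of x "A x"] normal_pairD(6)[OF N, of x]
    by simp
  then have "(norm (B x))\<^sup>2 = (norm (A x))\<^sup>2" by (simp flip: Re_cinner_self)
  then show ?thesis by (simp add: power2_eq_iff_nonneg)
qed

lemma normal_pair_shift:
  assumes "normal_pair A B"
  shows "normal_pair (\<lambda>x. A x - \<mu> *\<^sub>C x) (\<lambda>x. B x - cnj \<mu> *\<^sub>C x)"
  using normal_pairD[OF assms] unfolding normal_pair_def
  by (auto intro!: cbounded_diff cbounded_cscale
      simp: cinner_simps clinear_diff clinear_cscale cscale_diff_right mult.commute)

lemma closed_image_bounded_below:
  fixes A :: "'a::complex_hilbert \<Rightarrow> 'b::complex_hilbert"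
  assumes "cbounded A" "csubspace M" "closed M" "\<delta> > 0"
    and "\<And>x. x \<in> M \<Longrightarrow> \<delta> * norm x \<le> norm (A x)"
  shows "closed (A ` M)"
  using complete_isometric_image[OF \<open>\<delta> > 0\<close> csubspace_subspace[OF assms(2)] cbounded_bounded_linear[OF assms(1)]]
    assms by (auto simp: complete_eq_closed)

text \<open>The lower bound makes the range closed and the last hypothesis makes it dense; a lower
  bound alone would also hold for isometries that are not onto.\<close>

lemma bounded_below_surj:
  fixes A :: "'a::complex_hilbert \<Rightarrow> 'b::complex_hilbert"
  assumes A: "cbounded A" and "\<delta> > 0" "\<And>x. \<delta> * norm x \<le> norm (A x)"
    and "\<And>y. (\<And>x. cinner (A x) y = 0) \<Longrightarrow> y = 0"
  shows "bij A"
proof (rule bijI)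
  show "inj A"
  proof (rule injI)
    fix x y assume "A x = A y"
    then have "A (x - y) = 0" by (simp add: clinear_diff cbounded_clinear[OF A])
    with assms(2) assms(3)[of "x - y"] show "x = y" by (simp add: mult_le_0_iff)
  qed
  show "surj A"
  proof (rule orthogonal_zero_imp_UNIV)
    show "csubspace (range A)" by (intro csubspace_image cbounded_clinear A csubspace_UNIV)
    show "closed (range A)"
      using closed_image_bounded_below[OF A csubspace_UNIV closed_UNIV] assms by blast
  qed (use assms(4) in blast)
qed

text \<open>By normality the lower bound holds for \<open>B\<close> too, so the orthogonal
  complement of the range, which is the kernel of \<open>B\<close>, is trivial.\<close>

lemma normal_bounded_below_bij:
  assumes N: "normal_pair A B" and "\<delta> > 0" "\<And>x. \<delta> * norm x \<le> norm (A x)"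
  shows "bij A"
proof (rule bounded_below_surj)
  show "y = 0" if "\<And>x. cinner (A x) y = 0" for y
  proof -
    have "B y = 0" using that normal_pair_cinner[OF N] by (intro cinner_all_zero) metis
    then show ?thesis using normal_pair_norm[OF N, of y] assms(2) assms(3)[of y] by (simp add: mult_le_0_iff)
  qed
qed (use assms normal_pairD in auto)

text \<open>For a normal operator this amounts to closed range, and \<open>\<delta>\<close> is the
  radius of a punctured disc around \<open>0\<close> without spectrum.\<close>

definition bounded_below_off_kernel :: "real \<Rightarrow> ('a::complex_hilbert \<Rightarrow> 'a) \<Rightarrow> bool" where
  "bounded_below_off_kernel \<delta> A \<longleftrightarrow>
     \<delta> > 0 \<and> (\<forall>x. (\<forall>v. A v = 0 \<longrightarrow> cinner v x = 0) \<longrightarrow> \<delta> * norm x \<le> norm (A x))"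

lemma kernel_projection:
  assumes "cbounded A"
  obtains n where "A n = 0" "\<And>v. A v = 0 \<Longrightarrow> cinner v (x - n) = 0"
proof -
  have "closed {x. A x = 0}"
    by (intro closed_Collect_eq cbounded_continuous_on continuous_intros assms)
  from projection_exists[OF csubspace_kernel[OF cbounded_clinear[OF assms]] this, of x] that
  show ?thesis by auto
qed

text \<open>Since \<open>B\<close> annihilates the kernel as well, \<open>A\<close> maps the
  orthogonal complement of the kernel to itself; the bounds on the two parts combine by
  Pythagoras.\<close>

lemma bounded_below_off_kernel_near:
  assumes N: "normal_pair A B" and b: "bounded_below_off_kernel \<delta> A"
    and \<nu>: "0 < cmod \<nu>" "cmod \<nu> < \<delta>"
  shows "bij (\<lambda>x. A x - \<nu> *\<^sub>C x)"
proof (rule normal_bounded_below_bij[OF normal_pair_shift[OF N]])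
  \<comment> \<open>The two terms are the bounds on the complement of the kernel, where the shift
    costs \<open>cmod \<nu>\<close>, and on the kernel, where the shifted operator is multiplication
    by \<open>- \<nu>\<close>.\<close>
  define c where "c = min (\<delta> - cmod \<nu>) (cmod \<nu>)"
  show c: "c > 0" using \<nu> by (simp add: c_def)
  fix x
  obtain n where n: "A n = 0" "\<And>v. A v = 0 \<Longrightarrow> cinner v (x - n) = 0"
    using kernel_projection[OF normal_pairD(1)[OF N]] by blast
  define r where "r = x - n"
  have Bn: "B n = 0" using normal_pair_norm[OF N, of n] n by simp
  have nr: "cinner n r = 0" using n r_def by blast
  have "cinner n (A r) = 0" using normal_pairD(5)[OF N, of n r] Bn by simp
  then have o: "cinner (A r - \<nu> *\<^sub>C r) (\<nu> *\<^sub>C n) = 0"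
    using nr cinner_eq_zero_commute[of n r] cinner_eq_zero_commute[of n "A r"] by (simp add: cinner_simps)
  have "\<delta> * norm r \<le> norm (A r)" using b n r_def unfolding bounded_below_off_kernel_def by blast
  then have "(\<delta> - cmod \<nu>) * norm r \<le> norm (A r) - norm (\<nu> *\<^sub>C r)" by (simp add: algebra_simps)
  also have "\<dots> \<le> norm (A r - \<nu> *\<^sub>C r)" by (rule norm_triangle_ineq2)
  finally have "c * norm r \<le> norm (A r - \<nu> *\<^sub>C r)"
    by (rule order_trans[rotated]) (simp add: c_def mult_right_mono)
  then have 1: "(c * norm r)\<^sup>2 \<le> (norm (A r - \<nu> *\<^sub>C r))\<^sup>2" using c by (intro power_mono) auto
  have 2: "(c * norm n)\<^sup>2 \<le> (norm (\<nu> *\<^sub>C n))\<^sup>2"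
    using c by (intro power_mono) (auto simp: c_def intro!: mult_right_mono)
  have x: "x = r + n" by (simp add: r_def)
  have Ax: "A x - \<nu> *\<^sub>C x = (A r - \<nu> *\<^sub>C r) - \<nu> *\<^sub>C n"
    using n by (simp add: x clinear_add[OF normal_pairD(3)[OF N]] cscale_add_right)
  have "(c * norm x)\<^sup>2 = (c * norm r)\<^sup>2 + (c * norm n)\<^sup>2"
    using nr unfolding x power_mult_distrib norm_add_sq cinner_eq_zero_commute[of n r]
    by (simp add: algebra_simps)
  also have "\<dots> \<le> (norm (A r - \<nu> *\<^sub>C r))\<^sup>2 + (norm (\<nu> *\<^sub>C n))\<^sup>2" using 1 2 by simp
  also have "\<dots> = (norm (A x - \<nu> *\<^sub>C x))\<^sup>2" unfolding Ax norm_diff_sq[of "A r - \<nu> *\<^sub>C r"] o by simp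
  finally show "c * norm x \<le> norm (A x - \<nu> *\<^sub>C x)" by (rule power2_le_imp_le) simp
qed

text \<open>The orthogonal complement of the range is the kernel of \<open>B\<close>, which
  normality identifies with that of \<open>A\<close>.\<close>

lemma normal_range_eq:
  assumes N: "normal_pair A B" and cl: "closed (range A)"
  shows "y \<in> range A \<longleftrightarrow> (\<forall>v. A v = 0 \<longrightarrow> cinner v y = 0)"
proof
  assume "y \<in> range A"
  then obtain x where x: "y = A x" by blast
  show "\<forall>v. A v = 0 \<longrightarrow> cinner v y = 0"
    using normal_pair_norm[OF N] normal_pairD(5)[OF N] unfolding x
    by (metis cinner_zero_left norm_eq_zero)
next
  assume y: "\<forall>v. A v = 0 \<longrightarrow> cinner v y = 0"
  have "csubspace (range A)" by (intro csubspace_image csubspace_UNIV normal_pairD(3)[OF N])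
  then obtain m where m: "m \<in> range A" "\<And>v. v \<in> range A \<Longrightarrow> cinner v (y - m) = 0"
    using projection_exists cl by blast
  have "B (y - m) = 0"
    using m(2) normal_pair_cinner[OF N] by (intro cinner_all_zero) (metis rangeI)
  then have "A (y - m) = 0" using normal_pair_norm[OF N, of "y - m"] by simp
  with y have "cinner (y - m) y = 0" by blast
  moreover have "cinner (y - m) m = 0" using m cinner_eq_zero_commute by blast
  ultimately have "cinner (y - m) (y - m) = 0" by (simp add: cinner_diff_right)
  then show "y \<in> range A" using m by simp
qed

text \<open>The part of \<open>u\<close> off the kernel has a preimage \<open>w\<close>, so
  \<open>cinner x u = cinner (B x) w\<close> is at most \<open>norm w\<close> in modulus for every
  \<open>x\<close> in \<open>X\<close>. Weak boundedness of \<open>X\<close> then gives boundedness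
  in norm.\<close>

lemma normal_closed_range_bounded_below:
  assumes N: "normal_pair A B" and cl: "closed (range A)"
  obtains \<delta> where "bounded_below_off_kernel \<delta> A"
proof -
  define X where "X = {x. (\<forall>v. A v = 0 \<longrightarrow> cinner v x = 0) \<and> norm (A x) \<le> 1}"
  have "\<exists>K. \<forall>x\<in>X. cmod (cinner x u) \<le> K" for u
  proof -
    obtain n where n: "A n = 0" "\<And>v. A v = 0 \<Longrightarrow> cinner v (u - n) = 0"
      using kernel_projection[OF normal_pairD(1)[OF N]] by blast
    then obtain w where w: "u - n = A w" using normal_range_eq[OF N cl] by blast
    have "cmod (cinner x u) \<le> norm w" if "x \<in> X" for x
    proof -
      have "cinner x n = 0" using that n by (auto simp: X_def cinner_eq_zero_commute[of x n])
      then have "cinner x u = cinner x (u - n)" by (simp add: cinner_diff_right)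
      also have "\<dots> = cinner (B x) w" by (simp add: w normal_pairD(5)[OF N])
      also have "cmod \<dots> \<le> norm (B x) * norm w" by (rule cmod_cinner_le_norm)
      also have "\<dots> \<le> 1 * norm w"
        using that normal_pair_norm[OF N, of x] by (intro mult_right_mono) (auto simp: X_def)
      finally show ?thesis by simp
    qed
    then show ?thesis by blast
  qed
  then obtain K where K: "\<And>x. x \<in> X \<Longrightarrow> norm x \<le> K" using weakly_bounded_imp_bounded by blast
  have "norm x \<le> (\<bar>K\<bar> + 1) * norm (A x)" if x: "\<forall>v. A v = 0 \<longrightarrow> cinner v x = 0" for x
  proof (cases "A x = 0")
    case True
    with x have "cinner x x = 0" by blast
    then show ?thesis by simp
  next
    case False
    have "(1 / norm (A x)) *\<^sub>R x \<in> X"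
      using x False by (auto simp: X_def scaleR_cscale cinner_cscale_right norm_divide
          clinear_cscale[OF normal_pairD(3)[OF N]])
    from K[OF this] have "norm x / norm (A x) \<le> K" by simp
    then have "norm x \<le> K * norm (A x)" using False by (simp add: field_simps)
    also have "\<dots> \<le> (\<bar>K\<bar> + 1) * norm (A x)" by (intro mult_right_mono) auto
    finally show ?thesis .
  qed
  \<comment> \<open>Taking \<open>\<bar>K\<bar> + 1\<close> guarantees a positive constant to divide
    by.\<close>
  then have "bounded_below_off_kernel (1 / (\<bar>K\<bar> + 1)) A"
    by (simp add: bounded_below_off_kernel_def field_simps)
  then show ?thesis using that by blast
qed

text \<open>If \<open>\<alpha>\<close> is in the spectrum, it must be an eigenvalue, since a trivial
  kernel would turn the bound into bijectivity; the bound also isolates it with radius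
  \<open>\<delta>\<close>.\<close>

lemma not_ess_spectrumI:
  assumes N: "normal_pair A B" and F: "finite F" "{x. A x - \<alpha> *\<^sub>C x = 0} \<subseteq> cspan F"
    and b: "bounded_below_off_kernel \<delta> (\<lambda>x. A x - \<alpha> *\<^sub>C x)"
  shows "\<alpha> \<notin> ess_spectrum A"
proof
  assume "\<alpha> \<in> ess_spectrum A"
  then have \<alpha>: "\<alpha> \<in> spectrum A" "\<alpha> \<notin> discrete_spectrum A" by (auto simp: ess_spectrum_def)
  note N' = normal_pair_shift[OF N, of \<alpha>]
  have "\<exists>x. x \<noteq> 0 \<and> A x - \<alpha> *\<^sub>C x = 0"
  proof (rule ccontr)
    assume "\<not> ?thesis"
    then have "\<forall>v. A v - \<alpha> *\<^sub>C v = 0 \<longrightarrow> cinner v x = 0" for x by force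
    then have "\<delta> * norm x \<le> norm (A x - \<alpha> *\<^sub>C x)" for x
      using b unfolding bounded_below_off_kernel_def by blast
    then have "bij (\<lambda>x. A x - \<alpha> *\<^sub>C x)"
      using normal_bounded_below_bij[OF N'] b by (simp add: bounded_below_off_kernel_def)
    with \<alpha> show False by (simp add: spectrum_def)
  qed
  moreover have "ball \<alpha> \<delta> \<inter> spectrum A = {\<alpha>}"
  proof -
    have "\<mu> = \<alpha>" if "\<mu> \<in> ball \<alpha> \<delta>" "\<mu> \<in> spectrum A" for \<mu>
    proof (rule ccontr)
      assume "\<mu> \<noteq> \<alpha>"
      then have "bij (\<lambda>x. A x - \<alpha> *\<^sub>C x - (\<mu> - \<alpha>) *\<^sub>C x)"
        using that by (intro bounded_below_off_kernel_near[OF N' b]) (auto simp: dist_norm norm_minus_commute)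
      with that(2) show False by (simp add: spectrum_def cscale_diff_left)
    qed
    then show ?thesis using b \<alpha> by (auto simp: bounded_below_off_kernel_def)
  qed
  ultimately have "\<alpha> \<in> discrete_spectrum A"
    using \<alpha>(1) F b by (auto simp: discrete_spectrum_def bounded_below_off_kernel_def)
  with \<alpha> show False by simp
qed

text \<open>Discrete eigenvalues and points outside the spectrum are treated alike. In the second
  case bijectivity gives closed range, hence a lower bound and a disc free of spectrum.\<close>

lemma not_ess_spectrumD:
  assumes N: "normal_pair A B" and "\<alpha> \<notin> ess_spectrum A"
  shows "\<exists>F. finite F \<and> {x. A x - \<alpha> *\<^sub>C x = 0} \<subseteq> cspan F"
    and "\<exists>e>0. \<forall>\<mu>. 0 < cmod (\<mu> - \<alpha>) \<and> cmod (\<mu> - \<alpha>) < e \<longrightarrow> bij (\<lambda>x. A x - \<mu> *\<^sub>C x)"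
proof -
  note N' = normal_pair_shift[OF N, of \<alpha>]
  have "(\<exists>F. finite F \<and> {x. A x - \<alpha> *\<^sub>C x = 0} \<subseteq> cspan F) \<and>
    (\<exists>e>0. \<forall>\<mu>. 0 < cmod (\<mu> - \<alpha>) \<and> cmod (\<mu> - \<alpha>) < e \<longrightarrow> bij (\<lambda>x. A x - \<mu> *\<^sub>C x))"
  proof (cases "\<alpha> \<in> spectrum A")
    case True
    then have d: "\<alpha> \<in> discrete_spectrum A" using assms by (simp add: ess_spectrum_def)
    then obtain e where e: "e > 0" "ball \<alpha> e \<inter> spectrum A = {\<alpha>}"
      by (auto simp: discrete_spectrum_def)
    have "bij (\<lambda>x. A x - \<mu> *\<^sub>C x)" if "0 < cmod (\<mu> - \<alpha>)" "cmod (\<mu> - \<alpha>) < e" for \<mu>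
    proof -
      have "\<mu> \<in> ball \<alpha> e" "\<mu> \<noteq> \<alpha>" using that by (auto simp: dist_norm norm_minus_commute)
      with e(2) have "\<mu> \<notin> spectrum A" by blast
      then show ?thesis by (simp add: spectrum_def)
    qed
    moreover have "\<exists>F. finite F \<and> {x. A x - \<alpha> *\<^sub>C x = 0} \<subseteq> cspan F"
      using d by (simp add: discrete_spectrum_def)
    ultimately show ?thesis using e(1) by blast
  next
    case False
    then have bij: "bij (\<lambda>x. A x - \<alpha> *\<^sub>C x)" by (simp add: spectrum_def)
    then have "closed (range (\<lambda>x. A x - \<alpha> *\<^sub>C x))" by (simp add: bij_is_surj)
    then obtain \<delta> where b: "bounded_below_off_kernel \<delta> (\<lambda>x. A x - \<alpha> *\<^sub>C x)"
      using normal_closed_range_bounded_below[OF N'] by blast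
    have "bij (\<lambda>x. A x - \<mu> *\<^sub>C x)" if "0 < cmod (\<mu> - \<alpha>)" "cmod (\<mu> - \<alpha>) < \<delta>" for \<mu>
      using bounded_below_off_kernel_near[OF N' b that] by (simp add: cscale_diff_left)
    moreover have "{x. A x - \<alpha> *\<^sub>C x = 0} \<subseteq> cspan {}"
    proof clarsimp
      fix x assume "A x = \<alpha> *\<^sub>C x"
      then have "A x - \<alpha> *\<^sub>C x = A 0 - \<alpha> *\<^sub>C 0" by (simp add: clinear_zero[OF normal_pairD(3)[OF N]])
      with bij show "x = 0" by (meson bij_is_inj injD)
    qed
    moreover have "\<delta> > 0" using b by (simp add: bounded_below_off_kernel_def)
    ultimately show ?thesis by blast
  qed
  then show "\<exists>F. finite F \<and> {x. A x - \<alpha> *\<^sub>C x = 0} \<subseteq> cspan F"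
    and "\<exists>e>0. \<forall>\<mu>. 0 < cmod (\<mu> - \<alpha>) \<and> cmod (\<mu> - \<alpha>) < e \<longrightarrow> bij (\<lambda>x. A x - \<mu> *\<^sub>C x)"
    by auto
qed

section \<open>Self-adjoint operators\<close>

lemma symmetric_normal_pair:
  "cbounded S \<Longrightarrow> (\<And>x y. cinner (S x) y = cinner x (S y)) \<Longrightarrow> normal_pair S S"
  by (simp add: normal_pair_def)

lemma normal_pair_self_shift:
  "normal_pair S S \<Longrightarrow> normal_pair (\<lambda>x. S x - complex_of_real t *\<^sub>C x) (\<lambda>x. S x - complex_of_real t *\<^sub>C x)"
  using normal_pair_shift[of S S "complex_of_real t"] by simp

text \<open>Cauchy-Schwarz for the form of \<open>P\<close> is applied at \<open>x\<close> and
  \<open>P x\<close>; the form at \<open>P x\<close> is at most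
  \<open>K * (norm (P x))\<^sup>2\<close>, and one such square cancels. Lower bounds for
  \<open>norm (P x)\<close> thereby become lower bounds for the form.\<close>

lemma positive_norm_sq_le:
  assumes S: "normal_pair P P" and pos: "\<And>x. 0 \<le> Re (cinner x (P x))"
    and K: "\<And>x. norm (P x) \<le> K * norm x"
  shows "(norm (P x))\<^sup>2 \<le> K * Re (cinner x (P x))"
proof (cases "P x = 0")
  case True then show ?thesis by simp
next
  case False
  have "cinner x (P (P x)) = cinner (P x) (P x)" by (simp add: normal_pairD(5)[OF S])
  then have "((norm (P x))\<^sup>2)\<^sup>2 \<le> Re (cinner x (P x)) * Re (cinner (P x) (P (P x)))"
    using positive_form_Cauchy_Schwarz[OF normal_pairD(3,5)[OF S] pos, of x "P x"]
    by (simp only: Re_cinner_self)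
  also have "\<dots> \<le> Re (cinner x (P x)) * (norm (P x) * (K * norm (P x)))"
  proof (rule mult_left_mono[OF _ pos])
    have "Re (cinner (P x) (P (P x))) \<le> norm (P x) * norm (P (P x))"
      using Re_cinner_le_norm by (rule order_trans[OF abs_ge_self])
    also have "\<dots> \<le> norm (P x) * (K * norm (P x))" by (intro mult_left_mono K) simp
    finally show "Re (cinner (P x) (P (P x))) \<le> norm (P x) * (K * norm (P x))" .
  qed
  finally have "(norm (P x))\<^sup>2 * (norm (P x))\<^sup>2 \<le> (K * Re (cinner x (P x))) * (norm (P x))\<^sup>2"
    by (simp only: power2_eq_square mult_ac)
  then show ?thesis by (rule mult_right_le_imp_le) (use False in simp)
qed

text \<open>The infimum of the numerical range of a positive operator belongs to its spectrum.\<close>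
lemma numerical_lower_bound:
  assumes S: "normal_pair W W" and pos: "\<And>x. 0 \<le> Re (cinner x (W x))"
    and bij: "\<And>t. 0 \<le> t \<Longrightarrow> t < c \<Longrightarrow> bij (\<lambda>x. W x - complex_of_real t *\<^sub>C x)"
  shows "c * (norm x)\<^sup>2 \<le> Re (cinner x (W x))"
proof -
  define Q where "Q = (\<lambda>x. Re (cinner x (W x))) ` {x. norm x = 1}"
  have bdd: "bdd_below Q" using pos by (auto simp: Q_def intro!: bdd_belowI[of _ 0])
  have scale: "Re (cinner x (W x)) = (norm x)\<^sup>2 * Re (cinner ((1 / norm x) *\<^sub>R x) (W ((1 / norm x) *\<^sub>R x)))"
    if "x \<noteq> 0" for x
    using that unfolding scaleR_cscale clinear_cscale[OF normal_pairD(3)[OF S]]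
    by (simp add: cinner_simps power2_eq_square)
  show ?thesis
  proof (cases "x = 0")
    case True then show ?thesis by simp
  next
    case False
    define m where "m = Inf Q"
    have unit: "norm ((1 / norm y) *\<^sub>R y) = 1" if "y \<noteq> 0" for y :: 'a using that by simp
    have Qne: "Q \<noteq> {}" unfolding Q_def using unit[OF False] by blast
    have m0: "0 \<le> m" unfolding m_def using pos by (intro cInf_greatest Qne) (auto simp: Q_def)
    have mle: "m * (norm y)\<^sup>2 \<le> Re (cinner y (W y))" for y
    proof (cases "y = 0")
      case False
      have "m \<le> Re (cinner ((1 / norm y) *\<^sub>R y) (W ((1 / norm y) *\<^sub>R y)))"
        unfolding m_def using unit[OF False] by (intro cInf_lower bdd) (unfold Q_def, blast)
      from mult_left_mono[OF this, of "(norm y)\<^sup>2"] show ?thesis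
        by (simp only: scale[OF False] mult.commute) simp
    qed simp
    have "c \<le> m"
    proof (rule ccontr)
      assume "\<not> c \<le> m"
      \<comment> \<open>For \<open>m < c\<close> the shifted operator is bijective, hence bounded
        below by some \<open>\<delta>\<close>; this raises the infimum of the form by
        \<open>\<delta>\<^sup>2 / K\<close>, a contradiction.\<close>
      define P where "P = (\<lambda>x. W x - complex_of_real m *\<^sub>C x)"
      have bP: "bij P" unfolding P_def using bij m0 \<open>\<not> c \<le> m\<close> by simp
      have NP: "normal_pair P P" unfolding P_def by (rule normal_pair_self_shift[OF S])
      have Pq: "Re (cinner y (P y)) = Re (cinner y (W y)) - m * (norm y)\<^sup>2" for y
        by (simp add: P_def cinner_simps cinner_self_norm)
      then have posP: "0 \<le> Re (cinner y (P y))" for y using mle by simp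
      obtain K where "K > 0" and K: "\<And>y. norm (P y) \<le> K * norm y"
        using cbounded_pos[OF normal_pairD(1)[OF NP]] by blast
      have "closed (range P)" using bP by (simp add: bij_is_surj)
      then obtain \<delta> where b: "bounded_below_off_kernel \<delta> P"
        using normal_closed_range_bounded_below[OF NP] by blast
      then have \<delta>: "\<delta> > 0" by (simp add: bounded_below_off_kernel_def)
      have "v = 0" if "P v = 0" for v
        using bP that clinear_zero[OF normal_pairD(3)[OF NP]] by (metis bij_is_inj injD)
      then have bb: "\<delta> * norm y \<le> norm (P y)" for y
        using b unfolding bounded_below_off_kernel_def by (metis cinner_zero_left)
      have low: "m + \<delta>\<^sup>2 / K \<le> q" if q: "q \<in> Q" for q
      proof -
        obtain y where y: "norm y = 1" "q = Re (cinner y (W y))" using q by (auto simp: Q_def)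
        have "\<delta>\<^sup>2 \<le> (norm (P y))\<^sup>2" using bb[of y] \<delta> y by (intro power_mono) auto
        also have "\<dots> \<le> K * (q - m)" using positive_norm_sq_le[OF NP posP K, of y] Pq[of y] y by simp
        finally show ?thesis using \<open>K > 0\<close> by (simp add: field_simps)
      qed
      have "m + \<delta>\<^sup>2 / K \<le> m" unfolding m_def using low m_def by (intro cInf_greatest Qne) auto
      then show False using \<delta> \<open>K > 0\<close> by (simp add: field_simps)
    qed
    then have "c * (norm x)\<^sup>2 \<le> m * (norm x)\<^sup>2" by (intro mult_right_mono) auto
    with mle[of x] show ?thesis by simp
  qed
qed

text \<open>With \<open>s = e / 2\<close>, the gap gives \<open>(S - s)\<^sup>2 \<ge> s\<^sup>2\<close>, i.e. \<open>S\<^sup>2 \<ge> e S\<close>. Applied to \<open>y\<close> and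
  combined with the Cauchy--Schwarz inequality for the form of \<open>S\<close> at \<open>y, S y\<close>, this is the claim for
  \<open>x = S y\<close>; the range of \<open>S\<close> is dense in the orthogonal complement of its kernel.\<close>
lemma spectral_gap_bound:
  assumes S: "normal_pair S S" and pos: "\<And>x. 0 \<le> Re (cinner x (S x))" and "e > 0"
    and bij: "\<And>t. 0 < t \<Longrightarrow> t < e \<Longrightarrow> bij (\<lambda>x. S x - complex_of_real t *\<^sub>C x)"
    and x: "\<And>v. S v = 0 \<Longrightarrow> cinner v x = 0"
  shows "e * (norm x)\<^sup>2 \<le> Re (cinner x (S x))"
proof -
  define s where "s = e / 2"
  define R where "R = (\<lambda>x. S x - complex_of_real s *\<^sub>C x)"
  have NR: "normal_pair R R" unfolding R_def by (rule normal_pair_self_shift[OF S])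
  note lin = normal_pairD(3)[OF S] and linR = normal_pairD(3)[OF NR]
  have RR: "normal_pair (\<lambda>x. R (R x)) (\<lambda>x. R (R x))"
    by (rule symmetric_normal_pair[OF cbounded_compose[OF normal_pairD(1,1)[OF NR]]])
      (simp add: normal_pairD(5)[OF NR])
  have Rq: "Re (cinner y (R (R y))) = (norm (R y))\<^sup>2" for y
    using normal_pairD(5)[OF NR, of y "R y"] by (simp flip: Re_cinner_self)
  have "s\<^sup>2 * (norm y)\<^sup>2 \<le> Re (cinner y (R (R y)))" for y
  proof (rule numerical_lower_bound[OF RR])
    fix t assume t: "0 \<le> t" "t < s\<^sup>2"
    have s0: "0 < s" using \<open>e > 0\<close> by (simp add: s_def)
    \<comment> \<open>\<open>R (R x) - t x\<close> factors through \<open>S - (s + r)\<close> and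
      \<open>S - (s - r)\<close>, and both points lie strictly between \<open>0\<close> and
      \<open>e\<close>.\<close>
    define r where "r = sqrt t"
    have r: "0 \<le> r" "r < s" "r * r = t" using t s0 by (auto simp: r_def real_less_lsqrt)
    have "bij (\<lambda>x. S x - complex_of_real (s + r) *\<^sub>C x)" "bij (\<lambda>x. S x - complex_of_real (s - r) *\<^sub>C x)"
      using r by (intro bij; simp add: s_def)+
    from bij_comp[OF this]
    show "bij (\<lambda>x. R (R x) - complex_of_real t *\<^sub>C x)"
      by (rule back_subst[of bij])
        (auto simp: fun_eq_iff R_def clinear_add[OF lin] clinear_diff[OF lin] clinear_cscale[OF lin] cscale_diff_right
          cscale_add_left cscale_diff_left algebra_simps cscale_add_right r(3)[symmetric])
  qed (simp add: Rq)
  then have le: "s\<^sup>2 * (norm y)\<^sup>2 \<le> (norm (S y - complex_of_real s *\<^sub>C y))\<^sup>2" for y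
    unfolding Rq unfolding R_def .
  then have S2: "e * Re (cinner y (S y)) \<le> (norm (S y))\<^sup>2" for y
  proof -
    have "(norm (S y - complex_of_real s *\<^sub>C y))\<^sup>2 = (norm (S y))\<^sup>2 + s\<^sup>2 * (norm y)\<^sup>2 - e * Re (cinner y (S y))"
      using Re_cinner_commute[of "S y" y]
      by (simp add: norm_diff_sq power_mult_distrib power_divide cinner_cscale_right s_def)
    with le[of y] show ?thesis by simp
  qed
  have ran: "e * (norm (S y))\<^sup>2 \<le> Re (cinner (S y) (S (S y)))" for y
  proof (cases "S y = 0")
    case True then show ?thesis by simp
  next
    case False
    let ?q = "Re (cinner y (S y))"
    have "cinner y (S (S y)) = cinner (S y) (S y)" by (simp add: normal_pairD(5)[OF S])
    then have cs: "((norm (S y))\<^sup>2)\<^sup>2 \<le> ?q * Re (cinner (S y) (S (S y)))"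
      using positive_form_Cauchy_Schwarz[OF normal_pairD(3,5)[OF S] pos, of y "S y"]
      by (simp only: Re_cinner_self)
    have "?q \<noteq> 0" using cs False by auto
    then have q: "?q > 0" using pos[of y] by simp
    have "?q * (e * (norm (S y))\<^sup>2) \<le> (norm (S y))\<^sup>2 * (norm (S y))\<^sup>2"
      using mult_right_mono[OF S2[of y], of "(norm (S y))\<^sup>2"] by (simp add: mult_ac)
    also have "\<dots> \<le> ?q * Re (cinner (S y) (S (S y)))" using cs by (simp only: power2_eq_square)
    finally show ?thesis using q by simp
  qed
  have "csubspace (closure (range S))" by (intro csubspace_closure csubspace_image lin csubspace_UNIV)
  then obtain m where m: "m \<in> closure (range S)" "\<And>v. v \<in> closure (range S) \<Longrightarrow> cinner v (x - m) = 0"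
    using projection_exists closed_closure by blast
  \<comment> \<open>The part of \<open>x\<close> orthogonal to the range lies in the kernel of
    \<open>S\<close>, hence is orthogonal to \<open>x\<close> and so to itself.\<close>
  have "S (x - m) = 0"
  proof (rule cinner_all_zero)
    fix y
    have "S y \<in> closure (range S)" by (rule subsetD[OF closure_subset rangeI])
    from m(2)[OF this] show "cinner y (S (x - m)) = 0" by (simp add: normal_pairD(5)[OF S])
  qed
  then have "cinner (x - m) x = 0" by (rule x)
  moreover have "cinner (x - m) m = 0" using m cinner_eq_zero_commute by blast
  ultimately have "cinner (x - m) (x - m) = 0" by (simp only: cinner_diff_right diff_zero)
  then have "x \<in> closure (range S)" using m by simp
  moreover have "closure (range S) \<subseteq> {x. e * (norm x)\<^sup>2 \<le> Re (cinner x (S x))}"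
  proof (rule closure_minimal)
    \<comment> \<open>Polarisation expresses the form by norms, so closedness follows from
      continuity of \<open>S\<close> and of the norm.\<close>
    have "Re (cinner x (S x)) = ((norm (x + S x))\<^sup>2 - (norm x)\<^sup>2 - (norm (S x))\<^sup>2) / 2" for x
      by (simp add: norm_add_sq)
    then show "closed {x. e * (norm x)\<^sup>2 \<le> Re (cinner x (S x))}"
      by (simp only:) (intro closed_Collect_le continuous_intros cbounded_continuous_on normal_pairD(1)[OF S], simp)
  qed (use ran in auto)
  ultimately show ?thesis by blast
qed

text \<open>For symmetric \<open>S\<close> the imaginary part of
  \<open>cinner x (S x - \<mu> *\<^sub>C x)\<close> is \<open>- Im \<mu> * (norm x)\<^sup>2\<close>,
  which bounds the shifted operator below off the real axis.\<close>

lemma symmetric_spectrum_real: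
  assumes S: "normal_pair S S" and \<mu>: "\<mu> \<in> spectrum S"
  shows "\<mu> = complex_of_real (Re \<mu>)"
proof (rule ccontr)
  assume "\<mu> \<noteq> complex_of_real (Re \<mu>)"
  then have im: "Im \<mu> \<noteq> 0" by (simp add: complex_eq_iff)
  have "\<bar>Im \<mu>\<bar> * norm x \<le> norm (S x - \<mu> *\<^sub>C x)" for x
  proof -
    have "cinner x (S x) = cnj (cinner x (S x))"
      by (metis cinner_commute normal_pairD(5)[OF S])
    then have "Im (cinner x (S x)) = 0" by (simp add: complex_eq_iff)
    then have "Im (cinner x (S x - \<mu> *\<^sub>C x)) = - Im \<mu> * (norm x)\<^sup>2"
      by (simp add: cinner_simps cinner_self_norm)
    then have "\<bar>Im \<mu>\<bar> * (norm x)\<^sup>2 = \<bar>Im (cinner x (S x - \<mu> *\<^sub>C x))\<bar>" by (simp add: abs_mult)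
    also have "\<dots> \<le> norm x * norm (S x - \<mu> *\<^sub>C x)"
      using abs_Im_le_cmod cmod_cinner_le_norm by (rule order_trans)
    finally have "norm x * (\<bar>Im \<mu>\<bar> * norm x) \<le> norm x * norm (S x - \<mu> *\<^sub>C x)"
      by (simp only: power2_eq_square mult_ac)
    then show ?thesis by (cases "x = 0") auto
  qed
  then have "bij (\<lambda>x. S x - \<mu> *\<^sub>C x)"
    using im by (intro normal_bounded_below_bij[OF normal_pair_shift[OF S], of "\<bar>Im \<mu>\<bar>"]) auto
  with \<mu> show False by (simp add: spectrum_def)
qed

text \<open>Above \<open>m\<close>, the operator is bounded below on a subspace of finite codimension; hence its range is
  closed and its kernel is finite-dimensional.\<close>
lemma ess_spectrum_upper_bound:
  assumes S: "normal_pair S S" and F: "finite F"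
    and le: "\<And>x. (\<And>v. v \<in> F \<Longrightarrow> cinner v x = 0) \<Longrightarrow> Re (cinner x (S x)) \<le> m * (norm x)\<^sup>2"
    and \<mu>: "\<mu> \<in> ess_spectrum S"
  shows "Re \<mu> \<le> m"
proof (rule ccontr)
  assume "\<not> Re \<mu> \<le> m"
  define l where "l = Re \<mu>"
  have l: "m < l" using \<open>\<not> Re \<mu> \<le> m\<close> by (simp add: l_def)
  have \<mu>l: "\<mu> = complex_of_real l"
    using symmetric_spectrum_real[OF S] \<mu> by (simp add: ess_spectrum_def l_def)
  define G where "G = (\<lambda>x. S x - complex_of_real l *\<^sub>C x)"
  have NG: "normal_pair G G" unfolding G_def by (rule normal_pair_self_shift[OF S])
  let ?M = "{x. \<forall>v\<in>F. cinner v x = 0}"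
  have low: "(l - m) * norm x \<le> norm (G x)" if "x \<in> ?M" for x
  proof -
    have "Re (cinner x (G x)) = Re (cinner x (S x)) - l * (norm x)\<^sup>2"
      by (simp add: G_def cinner_simps cinner_self_norm)
    also have "\<dots> \<le> - ((l - m) * (norm x)\<^sup>2)" using le[of x] that by (simp add: algebra_simps)
    finally have "(l - m) * (norm x)\<^sup>2 \<le> norm x * norm (G x)" using Re_cinner_le_norm[of x "G x"] by linarith
    then have "norm x * ((l - m) * norm x) \<le> norm x * norm (G x)"
      by (simp only: power2_eq_square mult_ac)
    then show ?thesis by (cases "x = 0") auto
  qed
  have M: "csubspace (G ` ?M)" by (intro csubspace_image csubspace_orthogonal normal_pairD(3)[OF NG])
  have clM: "closed (G ` ?M)"
    by (rule closed_image_bounded_below[OF normal_pairD(1)[OF NG] csubspace_orthogonal closed_orthogonal _ low])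
      (use l in auto)
  \<comment> \<open>Splitting vectors along the span of \<open>F\<close> exhibits the range as a
    closed subspace plus a finite span.\<close>
  have "range G = {y. \<exists>z\<in>G ` ?M. y - z \<in> cspan (G ` F)}"
  proof (intro set_eqI iffI)
    fix y assume "y \<in> range G"
    then obtain x where x: "y = G x" by blast
    obtain w where w: "w \<in> cspan F" "\<And>v. v \<in> cspan F \<Longrightarrow> cinner v (x - w) = 0"
      using projection_exists[OF cspan_closed[OF F]] by blast
    have "x - w \<in> ?M" using w(2) cspan_superset[of F] by auto
    moreover have "y - G (x - w) = G w" by (simp add: x clinear_diff[OF normal_pairD(3)[OF NG]])
    moreover have "G w \<in> cspan (G ` F)" by (rule clinear_cspan[OF normal_pairD(3)[OF NG] F w(1)])
    ultimately show "y \<in> {y. \<exists>z\<in>G ` ?M. y - z \<in> cspan (G ` F)}" by force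
  next
    fix y assume "y \<in> {y. \<exists>z\<in>G ` ?M. y - z \<in> cspan (G ` F)}"
    then obtain z where z: "z \<in> range G" "y - z \<in> cspan (G ` F)" by blast
    obtain H c where H: "H \<subseteq> G ` F" "y - z = (\<Sum>v\<in>H. c v *\<^sub>C v)" using z(2) by (auto simp: cspan_def)
    have R: "csubspace (range G)" by (intro csubspace_image csubspace_UNIV normal_pairD(3)[OF NG])
    have "(\<Sum>v\<in>H. c v *\<^sub>C v) \<in> range G"
      using H(1) by (intro subspace_sum[OF csubspace_subspace[OF R]] csubspace_cscale[OF R]) auto
    then have "(y - z) + z \<in> range G" using H(2) z(1) csubspace_add[OF R] by simp
    then show "y \<in> range G" by simp
  qed
  then have "closed (range G)" using closed_add_cspan[OF finite_imageI[OF F] M clM] by simp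
  then obtain \<delta> where b: "bounded_below_off_kernel \<delta> G"
    using normal_closed_range_bounded_below[OF NG] by blast
  \<comment> \<open>The lower bound leaves no nonzero kernel vector in \<open>?M\<close>, so the
    finitely many functionals from \<open>F\<close> separate the kernel.\<close>
  have "x = 0" if "x \<in> {x. G x = 0}" "\<And>v. v \<in> F \<Longrightarrow> cinner v x = 0" for x
    using low[of x] that l by (auto simp: mult_le_0_iff)
  then obtain F' where "finite F'" "{x. G x = 0} \<subseteq> cspan F'"
    using csubspace_in_cspan[OF F csubspace_kernel[OF normal_pairD(3)[OF NG]]] by blast
  then have "\<mu> \<notin> ess_spectrum S"
    using b not_ess_spectrumI[OF S, of F' \<mu> \<delta>] by (simp add: G_def \<mu>l)
  with \<mu> show False by simp
qed

section \<open>Unitary operators\<close>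

lemma bij_cscale: "c \<noteq> 0 \<Longrightarrow> bij (\<lambda>x. c *\<^sub>C x)"
  by (rule o_bij[of "\<lambda>x. inverse c *\<^sub>C x"]) (auto simp: fun_eq_iff)

locale unitary_op =
  fixes U U' :: "'a::complex_hilbert \<Rightarrow> 'a"
  assumes normal: "normal_pair U U'" and UU': "U (U' x) = x" and U'U: "U' (U x) = x"
begin

lemmas lin = normal_pairD(3)[OF normal] and lin' = normal_pairD(4)[OF normal]

lemma norm_U: "norm (U x) = norm x"
proof -
  have "cinner (U x) (U x) = cinner x x" by (metis U'U normal_pairD(5)[OF normal])
  then have "(norm (U x))\<^sup>2 = (norm x)\<^sup>2" by (simp flip: Re_cinner_self)
  then show ?thesis by (simp add: power2_eq_iff_nonneg)
qed

text \<open>Bridge between \<open>U - 1\<close> and the real part: lower bounds for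
  \<open>norm (U x - x)\<close> become upper bounds for the form of \<open>ReOp U\<close>, and
  conversely.\<close>

lemma norm_U_diff_sq: "(norm (U x - x))\<^sup>2 = 2 * ((norm x)\<^sup>2 - Re (cinner x (U x)))"
  using Re_cinner_commute[of x "U x"] by (simp add: norm_diff_sq norm_U)

lemma Re_cinner_U': "Re (cinner x (U' x)) = Re (cinner x (U x))"
  by (metis Re_cinner_commute normal_pairD(5)[OF normal])

lemma ReOp_eq: "ReOp U = (\<lambda>x. (1/2) *\<^sub>C (U x + U' x))"
  unfolding ReOp_def adjoint_eqI[OF normal_pairD(5)[OF normal]] ..

lemma Re_cinner_ReOp: "Re (cinner x (ReOp U x)) = Re (cinner x (U x))"
  by (simp add: ReOp_eq cinner_simps Re_cinner_U')

lemma normal_ReOp: "normal_pair (ReOp U) (ReOp U)"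
proof (rule symmetric_normal_pair)
  show "cbounded (ReOp U)"
    unfolding ReOp_eq by (intro cbounded_scaled cbounded_add normal_pairD(1,2)[OF normal])
  show "cinner (ReOp U x) y = cinner x (ReOp U y)" for x y
    by (simp add: ReOp_eq cinner_simps normal_pairD(5)[OF normal] normal_pair_cinner[OF normal])
qed

text \<open>Equality case of \<open>Re (cinner x (U x)) \<le> (norm x)\<^sup>2\<close>: attaining
  the bound forces \<open>U x = x\<close>. Thus \<open>U\<close> and \<open>ReOp U\<close> have the
  same eigenvectors at \<open>1\<close>.\<close>

lemma ReOp_fixed_iff: "ReOp U x = x \<longleftrightarrow> U x = x"
proof
  assume "U x = x"
  moreover from this have "U' x = x" using U'U[of x] by simp
  ultimately show "ReOp U x = x" by (simp add: ReOp_eq scaleR_2[symmetric] scaleR_cscale)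
next
  assume "ReOp U x = x"
  then have "Re (cinner x (U x)) = (norm x)\<^sup>2" using Re_cinner_ReOp[of x] by (simp add: Re_cinner_self)
  then show "U x = x" using norm_U_diff_sq[of x] by simp
qed

text \<open>The condition through which the Fredholm property and the two conditions on essential
  spectra are compared. The factor in \<open>1 *\<^sub>C x\<close> keeps the shape of a shift by
  \<open>\<mu>\<close>.\<close>

definition gapped :: bool where
  "gapped \<longleftrightarrow> (\<exists>F. finite F \<and> {x. U x - 1 *\<^sub>C x = 0} \<subseteq> cspan F)
     \<and> (\<exists>\<delta>. bounded_below_off_kernel \<delta> (\<lambda>x. U x - 1 *\<^sub>C x))"

text \<open>The affine change \<open>S = 2 (1 - Re U)\<close> moves \<open>1 - t / 2\<close> to
  \<open>t\<close>, and its form at \<open>x\<close> is \<open>(norm (U x - x))\<^sup>2\<close>; a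
  gap of length \<open>e\<close> therefore bounds \<open>U - 1\<close> below by
  \<open>sqrt e\<close>.\<close>

lemma gappedI:
  assumes F: "finite F" "{x. U x - 1 *\<^sub>C x = 0} \<subseteq> cspan F" and "e > 0"
    and bij: "\<And>t. 0 < t \<Longrightarrow> t < e \<Longrightarrow> bij (\<lambda>x. ReOp U x - complex_of_real (1 - t / 2) *\<^sub>C x)"
  shows gapped
proof -
  define S where "S = (\<lambda>x. 2 *\<^sub>C (x - ReOp U x))"
  have S: "normal_pair S S"
  proof (rule symmetric_normal_pair)
    show "cbounded S"
      unfolding S_def by (intro cbounded_scaled cbounded_diff cbounded_ident normal_pairD(1)[OF normal_ReOp])
    show "cinner (S x) y = cinner x (S y)" for x y
      by (simp add: S_def cinner_simps normal_pairD(5)[OF normal_ReOp])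
  qed
  have Sq: "Re (cinner x (S x)) = (norm (U x - x))\<^sup>2" for x
    by (simp add: S_def cinner_simps norm_U_diff_sq Re_cinner_ReOp Re_cinner_self)
  have bS: "bij (\<lambda>x. S x - complex_of_real t *\<^sub>C x)" if "0 < t" "t < e" for t
  proof -
    have "bij ((\<lambda>x. (-2) *\<^sub>C x) \<circ> (\<lambda>x. ReOp U x - complex_of_real (1 - t / 2) *\<^sub>C x))"
      by (intro bij_comp bij bij_cscale that) simp
    also have "(\<lambda>x. (-2) *\<^sub>C x) \<circ> (\<lambda>x. ReOp U x - complex_of_real (1 - t / 2) *\<^sub>C x)
      = (\<lambda>x. S x - complex_of_real t *\<^sub>C x)"
      by (auto simp: fun_eq_iff S_def cscale_diff_right cscale_diff_left cscale_minus_left)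
    finally show ?thesis .
  qed
  have "bounded_below_off_kernel (sqrt e) (\<lambda>x. U x - 1 *\<^sub>C x)"
    unfolding bounded_below_off_kernel_def
  proof (intro conjI allI impI)
    fix x assume x: "\<forall>v. U v - 1 *\<^sub>C v = 0 \<longrightarrow> cinner v x = 0"
    have "U v = v" if "S v = 0" for v
    proof -
      have "v - ReOp U v = inverse 2 *\<^sub>C S v" by (simp add: S_def)
      then show ?thesis using that by (simp add: ReOp_fixed_iff[symmetric])
    qed
    then have "e * (norm x)\<^sup>2 \<le> Re (cinner x (S x))"
      using x by (intro spectral_gap_bound[OF S _ \<open>e > 0\<close> bS]) (auto simp: Sq)
    then have "(sqrt e * norm x)\<^sup>2 \<le> (norm (U x - 1 *\<^sub>C x))\<^sup>2"
      using \<open>e > 0\<close> by (simp add: Sq power_mult_distrib)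
    then show "sqrt e * norm x \<le> norm (U x - 1 *\<^sub>C x)" by (rule power2_le_imp_le) simp
  qed (use \<open>e > 0\<close> in simp)
  then show ?thesis using F by (auto simp: gapped_def)
qed

text \<open>For \<open>\<mu>\<close> on the unit circle, \<open>Re U - Re \<mu> = (1/2) U\<^sup>-\<^sup>1 (U - \<mu>) (U - cnj \<mu>)\<close>.\<close>
lemma bij_ReOp_shift:
  assumes \<mu>: "cmod \<mu> = 1" and bij: "bij (\<lambda>x. U x - \<mu> *\<^sub>C x)" "bij (\<lambda>x. U x - cnj \<mu> *\<^sub>C x)"
  shows "bij (\<lambda>x. ReOp U x - complex_of_real (Re \<mu>) *\<^sub>C x)"
proof -
  have 1: "\<mu> * cnj \<mu> = 1" using \<mu> by (simp add: complex_norm_square[symmetric])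
  have 2: "complex_of_real (Re \<mu>) = (1/2) * (\<mu> + cnj \<mu>)" by (simp add: complex_add_cnj)
  have "bij U'" by (rule o_bij[of U]) (auto simp: fun_eq_iff UU' U'U)
  then have "bij (((\<lambda>x. (1/2) *\<^sub>C x) \<circ> U') \<circ> ((\<lambda>x. U x - \<mu> *\<^sub>C x) \<circ> (\<lambda>x. U x - cnj \<mu> *\<^sub>C x)))"
    by (intro bij_comp bij bij_cscale) auto
  also have "((\<lambda>x. (1/2) *\<^sub>C x) \<circ> U') \<circ> ((\<lambda>x. U x - \<mu> *\<^sub>C x) \<circ> (\<lambda>x. U x - cnj \<mu> *\<^sub>C x))
      = (\<lambda>x. ReOp U x - complex_of_real (Re \<mu>) *\<^sub>C x)"
  proof
    fix x
    have *: "U (U x - cnj \<mu> *\<^sub>C x) - \<mu> *\<^sub>C (U x - cnj \<mu> *\<^sub>C x) = U (U x) - (\<mu> + cnj \<mu>) *\<^sub>C U x + x"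
      by (simp add: clinear_diff[OF lin] clinear_cscale[OF lin] cscale_diff_right cscale_add_left 1)
    show "(((\<lambda>x. (1/2) *\<^sub>C x) \<circ> U') \<circ> ((\<lambda>x. U x - \<mu> *\<^sub>C x) \<circ> (\<lambda>x. U x - cnj \<mu> *\<^sub>C x))) x
      = ReOp U x - complex_of_real (Re \<mu>) *\<^sub>C x"
      unfolding o_def * 2 ReOp_eq
      by (simp add: clinear_add[OF lin'] clinear_diff[OF lin'] clinear_cscale[OF lin'] U'U
          cscale_diff_right cscale_add_right)
  qed
  finally show ?thesis .
qed

lemma not_ess_spectrum_iff_gapped: "1 \<notin> ess_spectrum U \<longleftrightarrow> gapped"
proof
  assume "gapped"
  then show "1 \<notin> ess_spectrum U" using not_ess_spectrumI[OF normal] by (auto simp: gapped_def)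
next
  assume 1: "1 \<notin> ess_spectrum U"
  obtain F where F: "finite F" "{x. U x - 1 *\<^sub>C x = 0} \<subseteq> cspan F"
    using not_ess_spectrumD(1)[OF normal 1] by blast
  obtain e where e: "e > 0" "\<And>\<mu>. 0 < cmod (\<mu> - 1) \<Longrightarrow> cmod (\<mu> - 1) < e \<Longrightarrow> bij (\<lambda>x. U x - \<mu> *\<^sub>C x)"
    using not_ess_spectrumD(2)[OF normal 1] by blast
  show gapped
  proof (rule gappedI[OF F, of "min 4 (e\<^sup>2)"])
    fix t :: real assume t: "0 < t" "t < min 4 (e\<^sup>2)"
    \<comment> \<open>The point of the unit circle with real part \<open>1 - t / 2\<close>; its
      squared distance to \<open>1\<close> is \<open>t\<close>. The bound \<open>4\<close> keeps the
      radicand positive, and \<open>e\<^sup>2\<close> puts the point and its conjugate into the disc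
      where bijectivity is known.\<close>
    define \<mu> where "\<mu> = Complex (1 - t / 2) (sqrt (t - t\<^sup>2 / 4))"
    have pos: "0 < t - t\<^sup>2 / 4" using t by (simp add: power2_eq_square field_simps)
    have "(cmod \<mu>)\<^sup>2 = (1 - t / 2)\<^sup>2 + (t - t\<^sup>2 / 4)" using pos by (simp add: \<mu>_def cmod_power2)
    then have "(cmod \<mu>)\<^sup>2 = 1" by (simp add: power2_eq_square field_simps)
    then have m1: "cmod \<mu> = 1" using norm_ge_zero[of \<mu>] by (simp add: power2_eq_1_iff)
    have "(cmod (\<mu> - 1))\<^sup>2 = (t / 2)\<^sup>2 + (t - t\<^sup>2 / 4)" using pos by (simp add: \<mu>_def cmod_power2)
    then have "(cmod (\<mu> - 1))\<^sup>2 = t" by (simp add: power2_eq_square field_simps)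
    then have m2: "cmod (\<mu> - 1) = sqrt t" by (metis norm_ge_zero real_sqrt_abs abs_of_nonneg)
    have m3: "cmod (cnj \<mu> - 1) = sqrt t" using m2 by (metis complex_cnj_diff complex_cnj_one complex_mod_cnj)
    have "sqrt t < e" using t e(1) by (simp add: real_less_lsqrt)
    then have "bij (\<lambda>x. ReOp U x - complex_of_real (Re \<mu>) *\<^sub>C x)"
      using t m2 m3 by (intro bij_ReOp_shift m1 e(2)) auto
    then show "bij (\<lambda>x. ReOp U x - complex_of_real (1 - t / 2) *\<^sub>C x)" by (simp add: \<mu>_def)
  qed (use e in simp)
qed

lemma not_ess_spectrum_ReOp_imp_gapped:
  assumes 1: "1 \<notin> ess_spectrum (ReOp U)"
  shows gapped
proof -
  obtain F where F: "finite F" "{x. ReOp U x - 1 *\<^sub>C x = 0} \<subseteq> cspan F"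
    using not_ess_spectrumD(1)[OF normal_ReOp 1] by blast
  obtain e where e: "e > 0"
    "\<And>\<mu>. 0 < cmod (\<mu> - 1) \<Longrightarrow> cmod (\<mu> - 1) < e \<Longrightarrow> bij (\<lambda>x. ReOp U x - \<mu> *\<^sub>C x)"
    using not_ess_spectrumD(2)[OF normal_ReOp 1] by blast
  show gapped
  proof (rule gappedI[OF F(1), of "2 * e"])
    show "{x. U x - 1 *\<^sub>C x = 0} \<subseteq> cspan F" using F(2) by (simp add: ReOp_fixed_iff)
    show "bij (\<lambda>x. ReOp U x - complex_of_real (1 - t / 2) *\<^sub>C x)" if t: "0 < t" "t < 2 * e" for t
    proof -
      have "cmod (complex_of_real (1 - t / 2) - 1) = t / 2"
        using t by (simp add: norm_divide)
      then show ?thesis using t by (intro e(2)) auto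
    qed
  qed (use e in simp)
qed

text \<open>Orthogonality to \<open>F\<close> implies orthogonality to the kernel, so the lower
  bound \<open>\<delta>\<close> applies, and \<open>norm_U_diff_sq\<close> yields
  \<open>m = 1 - \<delta>\<^sup>2 / 2\<close>. With \<open>F\<close> in place of the kernel the
  bound can be compared for different unitaries.\<close>

lemma gapped_imp_form_bound:
  assumes gapped
  obtains F m where "finite F" "m < 1"
    "\<And>x. (\<And>v. v \<in> F \<Longrightarrow> cinner v x = 0) \<Longrightarrow> Re (cinner x (U x)) \<le> m * (norm x)\<^sup>2"
proof -
  obtain F \<delta> where F: "finite F" "{x. U x - 1 *\<^sub>C x = 0} \<subseteq> cspan F"
    and b: "bounded_below_off_kernel \<delta> (\<lambda>x. U x - 1 *\<^sub>C x)"
    using assms by (auto simp: gapped_def)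
  have \<delta>: "\<delta> > 0" using b by (simp add: bounded_below_off_kernel_def)
  have "Re (cinner x (U x)) \<le> (1 - \<delta>\<^sup>2 / 2) * (norm x)\<^sup>2" if x: "\<And>v. v \<in> F \<Longrightarrow> cinner v x = 0" for x
  proof -
    have "cinner v x = 0" if "U v - 1 *\<^sub>C v = 0" for v
      using orthogonal_cspan[of F x v] x F(2) that by blast
    then have "\<delta> * norm x \<le> norm (U x - x)" using b by (simp add: bounded_below_off_kernel_def)
    then have "(\<delta> * norm x)\<^sup>2 \<le> (norm (U x - x))\<^sup>2" using \<delta> by (intro power_mono) auto
    then show ?thesis by (simp add: norm_U_diff_sq power_mult_distrib algebra_simps)
  qed
  with F(1) \<delta> show ?thesis by (intro that[of F "1 - \<delta>\<^sup>2 / 2"]) auto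
qed

lemma ess_spectrum_ReOp_le:
  assumes "finite F"
    "\<And>x. (\<And>v. v \<in> F \<Longrightarrow> cinner v x = 0) \<Longrightarrow> Re (cinner x (U x)) \<le> m * (norm x)\<^sup>2"
    "\<mu> \<in> ess_spectrum (ReOp U)"
  shows "Re \<mu> \<le> m"
  using ess_spectrum_upper_bound[OF normal_ReOp assms(1) _ assms(3)] assms(2)
  by (simp add: Re_cinner_ReOp)

lemma ess_spectrum_ReOp_less_iff_gapped: "(\<forall>\<mu>\<in>ess_spectrum (ReOp U). Re \<mu> < 1) \<longleftrightarrow> gapped"
proof
  assume "\<forall>\<mu>\<in>ess_spectrum (ReOp U). Re \<mu> < 1"
  then have "1 \<notin> ess_spectrum (ReOp U)" by force
  then show gapped by (rule not_ess_spectrum_ReOp_imp_gapped)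
next
  assume gapped
  then obtain F m where "finite F" "m < 1"
    "\<And>x. (\<And>v. v \<in> F \<Longrightarrow> cinner v x = 0) \<Longrightarrow> Re (cinner x (U x)) \<le> m * (norm x)\<^sup>2"
    using gapped_imp_form_bound by blast
  then show "\<forall>\<mu>\<in>ess_spectrum (ReOp U). Re \<mu> < 1"
    using ess_spectrum_ReOp_le by (meson le_less_trans)
qed

text \<open>The range is the image of the complement of the kernel, so the lower bound makes it
  closed. It then equals that complement, and the finite set whose span contains the kernel also
  covers the cokernel.\<close>

lemma fredholm_iff_gapped: "fredholm (\<lambda>x. U x - 1 *\<^sub>C x) \<longleftrightarrow> gapped"
proof
  note N = normal_pair_shift[OF normal, of 1]
  show gapped if "fredholm (\<lambda>x. U x - 1 *\<^sub>C x)"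
    using that normal_closed_range_bounded_below[OF N] unfolding fredholm_def gapped_def by metis
  assume gapped
  then obtain F \<delta> where F: "finite F" "{x. U x - 1 *\<^sub>C x = 0} \<subseteq> cspan F"
    and b: "bounded_below_off_kernel \<delta> (\<lambda>x. U x - 1 *\<^sub>C x)"
    by (auto simp: gapped_def)
  define A where "A = (\<lambda>x. U x - 1 *\<^sub>C x)"
  have NA: "normal_pair A (\<lambda>x. U' x - cnj 1 *\<^sub>C x)" using N by (simp only: A_def)
  have kerA: "{x. A x = 0} \<subseteq> cspan F" and bA: "bounded_below_off_kernel \<delta> A"
    using F(2) b by (simp_all only: A_def)
  let ?M = "{x. \<forall>v\<in>{v. A v = 0}. cinner v x = 0}"
  have dec: "\<exists>n. A n = 0 \<and> y - n \<in> ?M" for y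
  proof -
    obtain n where "A n = 0" "\<And>v. A v = 0 \<Longrightarrow> cinner v (y - n) = 0"
      using kernel_projection[OF normal_pairD(1)[OF NA]] by blast
    then show ?thesis by blast
  qed
  have "range A = A ` ?M"
  proof
    show "range A \<subseteq> A ` ?M"
    proof clarify
      fix x
      obtain n where n: "A n = 0" "x - n \<in> ?M" using dec by blast
      then have "A x = A (x - n)" using clinear_diff[OF normal_pairD(3)[OF NA], of x n] by simp
      with n(2) show "A x \<in> A ` ?M" by blast
    qed
  qed blast
  also have "closed (A ` ?M)"
    using bA by (intro closed_image_bounded_below[OF normal_pairD(1)[OF NA] csubspace_orthogonal closed_orthogonal])
      (auto simp: bounded_below_off_kernel_def)
  finally have cl: "closed (range A)" .
  have "\<exists>x. y - A x \<in> cspan F" for y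
  proof -
    obtain n where n: "A n = 0" "y - n \<in> ?M" using dec by blast
    then have "y - n \<in> range A" using normal_range_eq[OF NA cl] by blast
    then obtain x where "y - n = A x" by blast
    then have "y - A x = n" by (metis diff_diff_eq2 add_diff_cancel_left')
    with n kerA show ?thesis by blast
  qed
  with F(1) kerA cl normal_pairD(1)[OF NA] have "fredholm A" unfolding fredholm_def by blast
  then show "fredholm (\<lambda>x. U x - 1 *\<^sub>C x)" by (simp only: A_def)
qed

end

text \<open>For a bounded operator, being Fredholm depends on kernel and range only: closedness of
  the range pulls back along \<open>W\<close>, and \<open>W'\<close> moves the finite set that
  covers the cokernel.\<close>

lemma fredholm_transfer:
  fixes A B :: "'a::complex_hilbert \<Rightarrow> 'a"
  assumes "cbounded A" and W: "cbounded W" "cbounded W'" "\<And>y. W (W' y) = y" "\<And>y. W' (W y) = y"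
    and ker: "\<And>x. A x = 0 \<longleftrightarrow> B x = 0" and ran: "\<And>y. y \<in> range A \<longleftrightarrow> W y \<in> range B"
    and B: "fredholm B"
  shows "fredholm A"
  unfolding fredholm_def
proof (intro conjI)
  show "\<exists>F. finite F \<and> {x. A x = 0} \<subseteq> cspan F" using B ker by (simp add: fredholm_def)
  have "range A = W -` range B" using ran by auto
  moreover have "closed (range B)" using B by (simp add: fredholm_def)
  ultimately show "closed (range A)"
    using continuous_closed_preimage[OF cbounded_continuous_on[OF W(1)] closed_UNIV, of "range B"] by simp
  obtain F where F: "finite F" "\<And>y. \<exists>x. y - B x \<in> cspan F" using B by (auto simp: fredholm_def)
  have "\<exists>x. y - A x \<in> cspan (W' ` F)" for y
  proof -
    obtain x where x: "W y - B x \<in> cspan F" using F by blast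
    have "W' (B x) \<in> range A" by (simp add: ran W(3))
    then obtain x' where x': "W' (B x) = A x'" by blast
    have "W' (W y - B x) \<in> cspan (W' ` F)" by (rule clinear_cspan[OF cbounded_clinear[OF W(2)] F(1) x])
    then show ?thesis using x' by (auto simp: clinear_diff[OF cbounded_clinear[OF W(2)]] W(4))
  qed
  then show "\<exists>F. finite F \<and> (\<forall>y. \<exists>x. y - A x \<in> cspan F)" using F(1) by blast
qed (rule assms(1))

section \<open>J-unitary operators and the scattering matrix\<close>

lemma fst_cscale: "fst (c *\<^sub>C p) = c *\<^sub>C fst p" and snd_cscale: "snd (c *\<^sub>C p) = c *\<^sub>C snd p"
  by (simp_all add: cscale_prod_def)

lemma cbounded_fst: "cbounded fst" and cbounded_snd: "cbounded snd"
  by (auto simp: cbounded_def clinear_def cscale_prod_def intro!: exI[of _ 1] norm_fst_le norm_snd_le)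

lemma cbounded_inl: "cbounded (\<lambda>x. (x, 0))" and cbounded_inr: "cbounded (\<lambda>y. (0, y))"
  by (auto simp: cbounded_def clinear_def cscale_prod_def norm_Pair intro!: exI[of _ 1])

lemma clinear_Jop: "clinear Jop"
  by (simp add: clinear_def Jop_def cscale_prod_def cscale_minus_right)

lemma norm_Jop [simp]: "norm (Jop p) = norm p"
  by (simp add: Jop_def norm_prod_def)

lemma cbounded_Jop: "cbounded Jop"
  using clinear_Jop by (auto simp: cbounded_def intro!: exI[of _ 1])

lemma Jop_Jop [simp]: "Jop (Jop p) = p"
  by (simp add: Jop_def)

lemma cinner_Jop: "cinner p (Jop q) = cinner (fst p) (fst q) - cinner (snd p) (snd q)"
  by (simp add: cinner_prod_def Jop_def cinner_minus_right)

text \<open>J-unitarity as invariance of an indefinite form; in this shape it passes to rotations of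
  \<open>T\<close> at once and gives identities between components.\<close>

locale J_form =
  fixes T :: "'h::complex_hilbert \<times> 'h \<Rightarrow> 'h \<times> 'h"
  assumes bounded: "cbounded T" and bij: "bij T"
    and form: "cinner (T p) (Jop (T q)) = cinner p (Jop q)"
begin

lemmas lin = cbounded_clinear[OF bounded]

lemma form_components:
  "cinner (fst (T p)) (fst (T q)) - cinner (snd (T p)) (snd (T q))
    = cinner (fst p) (fst q) - cinner (snd p) (snd q)"
  using form[of p q] by (simp only: cinner_Jop)

lemma norm_components:
  "(norm (fst (T p)))\<^sup>2 - (norm (snd (T p)))\<^sup>2 = (norm (fst p))\<^sup>2 - (norm (snd p))\<^sup>2"
  using arg_cong[OF form_components[of p p], of Re] by (simp add: Re_cinner_self)

lemma T_Pair: "T (x, y) = (blk_a T x + blk_b T y, blk_c T x + blk_d T y)"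
proof -
  have "T (x, y) = T (x, 0) + T (0, y)" by (simp add: clinear_add[OF lin, symmetric])
  then show ?thesis by (simp add: blk_a_def blk_b_def blk_c_def blk_d_def prod_eq_iff)
qed

lemma cbounded_blk_a: "cbounded (blk_a T)"
  unfolding blk_a_def[abs_def] by (rule cbounded_compose[OF cbounded_fst cbounded_compose[OF bounded cbounded_inl]])

lemma cbounded_blk_d: "cbounded (blk_d T)"
  unfolding blk_d_def[abs_def] by (rule cbounded_compose[OF cbounded_snd cbounded_compose[OF bounded cbounded_inr]])

text \<open>The form at \<open>(x, 0)\<close> shows that \<open>a\<close> does not shrink norms. If
  \<open>y\<close> is orthogonal to the range of \<open>a\<close>, then a preimage
  \<open>(u, v)\<close> of \<open>(y, 0)\<close> has \<open>u = 0\<close>, and the norm identity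
  forces \<open>y = 0\<close>.\<close>

lemma bij_blk_a: "bij (blk_a T)"
proof (rule bounded_below_surj[OF cbounded_blk_a, of 1])
  show "1 * norm x \<le> norm (blk_a T x)" for x
  proof (rule power2_le_imp_le)
    show "(1 * norm x)\<^sup>2 \<le> (norm (blk_a T x))\<^sup>2"
      using norm_components[of "(x, 0)"] zero_le_power2[of "norm (snd (T (x, 0)))"]
      unfolding blk_a_def fst_conv snd_conv by (simp only: norm_zero power_zero_numeral mult_1_left)
  qed simp
  show "y = 0" if y: "\<And>x. cinner (blk_a T x) y = 0" for y
  proof -
    obtain u v where uv: "T (u, v) = (y, 0)" using bij by (metis bij_pointE surj_pair)
    have "cinner x u = 0" for x
      using form_components[of "(x, 0)" "(u, v)"] y[of x] uv by (simp add: blk_a_def)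
    then have "u = 0" by (rule cinner_all_zero)
    then have "(norm y)\<^sup>2 = - (norm v)\<^sup>2" using norm_components[of "(u, v)"] uv by simp
    then have "(norm y)\<^sup>2 \<le> 0" by simp
    then show ?thesis by simp
  qed
qed simp

lemma bij_blk_d: "bij (blk_d T)"
proof (rule bounded_below_surj[OF cbounded_blk_d, of 1])
  show "1 * norm y \<le> norm (blk_d T y)" for y
  proof (rule power2_le_imp_le)
    show "(1 * norm y)\<^sup>2 \<le> (norm (blk_d T y))\<^sup>2"
      using norm_components[of "(0, y)"] zero_le_power2[of "norm (fst (T (0, y)))"]
      unfolding blk_d_def fst_conv snd_conv by (simp only: norm_zero power_zero_numeral mult_1_left)
  qed simp
  show "y = 0" if y: "\<And>x. cinner (blk_d T x) y = 0" for y
  proof -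
    obtain u v where uv: "T (u, v) = (0, y)" using bij by (metis bij_pointE surj_pair)
    have "cinner x v = 0" for x
      using form_components[of "(0, x)" "(u, v)"] y[of x] uv by (simp add: blk_d_def)
    then have "v = 0" by (rule cinner_all_zero)
    then have "- (norm y)\<^sup>2 = (norm u)\<^sup>2" using norm_components[of "(u, v)"] uv by simp
    then have "(norm y)\<^sup>2 \<le> 0" by (metis neg_le_0_iff_le zero_le_power2 minus_minus)
    then show ?thesis by simp
  qed
qed simp

text \<open>\<open>V T\<close> is the scattering matrix of the transfer matrix \<open>T\<close>: it maps the pair
  (first input, second output) to the pair (first output, second input).\<close>
definition in_map :: "'h \<times> 'h \<Rightarrow> 'h \<times> 'h" where "in_map p = (fst p, snd (T p))"
definition out_map :: "'h \<times> 'h \<Rightarrow> 'h \<times> 'h" where "out_map p = (fst (T p), snd p)"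

text \<open>The one entry that needs an argument is the inverse of the adjoint of \<open>a\<close>,
  which equals \<open>a - b d\<^sup>-\<^sup>1 c\<close>: with \<open>e\<close> as
  \<open>d\<^sup>-\<^sup>1 c x\<close>, the second component of \<open>T (x, - e)\<close> vanishes,
  so the form tested against \<open>(v, 0)\<close> is a pairing with \<open>a v\<close>
  alone.\<close>

lemma Vop_in_map: "Vop T (in_map p) = out_map p"
proof -
  obtain x y where p: "p = (x, y)" by (cases p)
  let ?a = "blk_a T" and ?b = "blk_b T" and ?c = "blk_c T" and ?d = "blk_d T"
  define e where "e = inv ?d (?c x)"
  have de: "?d e = ?c x" by (simp add: e_def surj_f_inv_f[OF bij_is_surj[OF bij_blk_d]])
  have "?c x + ?d y = ?d (e + y)" by (simp add: de clinear_add[OF cbounded_clinear[OF cbounded_blk_d]])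
  then have inv: "inv ?d (?c x + ?d y) = e + y"
    by (simp add: inv_f_f[OF bij_is_inj[OF bij_blk_d]])
  have b_add: "?b (u + v) = ?b u + ?b v" for u v
    using clinear_add[OF lin, of "(0, u)" "(0, v)"] by (simp add: blk_b_def)
  have T0: "T (x, - e) = (?a x + ?b (- e), 0)"
    using de by (simp add: T_Pair clinear_minus[OF cbounded_clinear[OF cbounded_blk_d]])
  have "cinner (adjoint ?a (?a x + ?b (- e))) v = cinner x v" for v
    using form_components[of "(x, - e)" "(v, 0)"] T0
    by (simp add: cinner_adjoint_left[OF cbounded_blk_a] blk_a_def)
  then have adj: "adjoint ?a (?a x + ?b (- e)) = x" by (rule cinner_ext)
  have "inj (adjoint ?a)"
  proof (rule injI)
    fix u w assume uw: "adjoint ?a u = adjoint ?a w"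
    show "u = w"
    proof (rule cinner_ext)
      fix v
      obtain v' where "v = ?a v'" using bij_is_surj[OF bij_blk_a] by blast
      then show "cinner u v = cinner w v"
        using uw by (simp add: cinner_adjoint_left[OF cbounded_blk_a, symmetric])
    qed
  qed
  then have inva: "inv (adjoint ?a) x = ?a x + ?b (- e)" using adj by (metis inv_f_f)
  have "Vop T (in_map p) = (?a x + ?b (- e) + ?b (e + y), - e + (e + y))"
    by (simp add: p in_map_def Vop_def T_Pair inva inv e_def)
  also have "\<dots> = (?a x + ?b y, y)" by (simp add: add.assoc b_add[symmetric])
  finally show ?thesis by (simp add: p out_map_def T_Pair)
qed

lemma surj_in_map: "\<exists>p. q = in_map p"
proof -
  obtain x z where q: "q = (x, z)" by (cases q)
  obtain y where "blk_d T y = z - blk_c T x" by (metis bij_blk_d bij_pointE)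
  then have "q = in_map (x, y)" by (simp add: q in_map_def T_Pair)
  then show ?thesis ..
qed

lemma surj_out_map: "\<exists>p. q = out_map p"
proof -
  obtain z y where q: "q = (z, y)" by (cases q)
  obtain x where "blk_a T x = z - blk_b T y" by (metis bij_blk_a bij_pointE)
  then have "q = out_map (x, y)" by (simp add: q out_map_def T_Pair)
  then show ?thesis ..
qed

text \<open>Moving the negative terms of the indefinite identity to the other side makes both sides
  definite; this is why \<open>Vop T\<close> is unitary.\<close>

lemma cinner_out_map: "cinner (out_map p) (out_map q) = cinner (in_map p) (in_map q)"
  using form_components[of p q] by (simp add: in_map_def out_map_def cinner_prod_def algebra_simps)

lemma cinner_Vop: "cinner (Vop T p) (Vop T q) = cinner p q"
  using surj_in_map[of p] surj_in_map[of q] by (auto simp: Vop_in_map cinner_out_map)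

lemma clinear_in_map: "clinear in_map" and clinear_out_map: "clinear out_map"
  by (auto simp: clinear_def in_map_def out_map_def clinear_add[OF lin] clinear_cscale[OF lin]
      fst_cscale snd_cscale prod_eq_iff)

lemma clinear_Vop: "clinear (Vop T)"
  unfolding clinear_def
proof (intro conjI allI)
  fix p q
  obtain p' q' where "p = in_map p'" "q = in_map q'" using surj_in_map by blast
  then show "Vop T (p + q) = Vop T p + Vop T q"
    by (simp add: Vop_in_map clinear_add[OF clinear_out_map] flip: clinear_add[OF clinear_in_map])
next
  fix c p
  obtain p' where "p = in_map p'" using surj_in_map by blast
  then show "Vop T (c *\<^sub>C p) = c *\<^sub>C Vop T p"
    by (simp add: Vop_in_map clinear_cscale[OF clinear_out_map] flip: clinear_cscale[OF clinear_in_map])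
qed

lemma norm_Vop: "norm (Vop T p) = norm p"
proof -
  have "(norm (Vop T p))\<^sup>2 = (norm p)\<^sup>2" using cinner_Vop[of p p] by (simp flip: Re_cinner_self)
  then show ?thesis by (simp add: power2_eq_iff_nonneg)
qed

lemma bij_Vop: "bij (Vop T)"
proof (rule bijI)
  show "inj (Vop T)"
  proof (rule injI)
    fix p q assume "Vop T p = Vop T q"
    then have "Vop T (p - q) = 0" by (simp add: clinear_diff[OF clinear_Vop])
    then show "p = q" using norm_Vop[of "p - q"] by simp
  qed
  show "surj (Vop T)" using surj_out_map Vop_in_map by (metis surjI surj_def)
qed

lemma unitary_Vop: "unitary_op (Vop T) (inv (Vop T))"
proof
  have VV: "Vop T (inv (Vop T) p) = p" and V'V: "inv (Vop T) (Vop T p) = p" for p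
    by (simp_all add: surj_f_inv_f[OF bij_is_surj[OF bij_Vop]] inv_f_f[OF bij_is_inj[OF bij_Vop]])
  have lin': "clinear (inv (Vop T))"
    unfolding clinear_def using VV V'V clinear_add[OF clinear_Vop] clinear_cscale[OF clinear_Vop] by metis
  have "cbounded (Vop T)" using clinear_Vop norm_Vop by (auto simp: cbounded_def intro!: exI[of _ 1])
  moreover have "norm (inv (Vop T) p) = norm p" for p using norm_Vop[of "inv (Vop T) p"] VV by simp
  then have "cbounded (inv (Vop T))" using lin' by (auto simp: cbounded_def intro!: exI[of _ 1])
  moreover have "cinner (inv (Vop T) p) q = cinner p (Vop T q)" for p q
    using cinner_Vop[of "inv (Vop T) p" q] VV by simp
  ultimately show "normal_pair (Vop T) (inv (Vop T))" by (simp add: normal_pair_def VV V'V)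
  show "Vop T (inv (Vop T) p) = p" "inv (Vop T) (Vop T p) = p" for p by (fact VV V'V)+
qed

text \<open>In the second component the roles of \<open>p\<close> and \<open>T p\<close> are
  exchanged between input and output, and \<open>Jop\<close> undoes the resulting sign.\<close>

lemma T_diff: "T p - p = Jop (Vop T (in_map p) - 1 *\<^sub>C in_map p)"
  by (simp add: Vop_in_map) (simp add: in_map_def out_map_def Jop_def prod_eq_iff)

text \<open>A fixed vector of \<open>T\<close> is its own \<open>in_map\<close>, so the substitution
  disappears and the kernels coincide instead of merely corresponding.\<close>

lemma fixed_iff: "T p - p = 0 \<longleftrightarrow> Vop T p - 1 *\<^sub>C p = 0"
proof
  assume T: "T p - p = 0"
  then have "in_map p = p" by (simp add: in_map_def)
  moreover have "Jop (T p - p) = Vop T (in_map p) - 1 *\<^sub>C in_map p" unfolding T_diff by (rule Jop_Jop)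
  ultimately show "Vop T p - 1 *\<^sub>C p = 0" using T by (simp add: clinear_zero[OF clinear_Jop])
next
  assume V: "Vop T p - 1 *\<^sub>C p = 0"
  obtain q where q: "p = in_map q" using surj_in_map by blast
  have Tq: "T q - q = 0" using T_diff[of q] V by (simp add: q clinear_zero[OF clinear_Jop])
  then have "p = q" by (simp add: q in_map_def)
  with Tq show "T p - p = 0" by simp
qed

lemma range_iff: "y \<in> range (\<lambda>p. T p - p) \<longleftrightarrow> Jop y \<in> range (\<lambda>p. Vop T p - 1 *\<^sub>C p)"
proof
  assume "y \<in> range (\<lambda>p. T p - p)"
  then obtain p where "y = T p - p" by blast
  then have "Jop y = Vop T (in_map p) - 1 *\<^sub>C in_map p" unfolding T_diff by (simp only: Jop_Jop)
  then show "Jop y \<in> range (\<lambda>p. Vop T p - 1 *\<^sub>C p)" by blast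
next
  assume "Jop y \<in> range (\<lambda>p. Vop T p - 1 *\<^sub>C p)"
  then obtain q where q: "Jop y = Vop T q - 1 *\<^sub>C q" by blast
  obtain p where "q = in_map p" using surj_in_map by blast
  then have "T p - p = Jop (Jop y)" unfolding q by (simp only: T_diff)
  then have "y = T p - p" by simp
  then show "y \<in> range (\<lambda>p. T p - p)" by blast
qed

section \<open>Rotation by points of the unit circle\<close>

lemma J_form_rotate:
  assumes "cmod z = 1"
  shows "J_form (\<lambda>p. cnj z *\<^sub>C T p)"
proof
  show "cbounded (\<lambda>p. cnj z *\<^sub>C T p)" by (rule cbounded_scaled[OF bounded])
  have "z \<noteq> 0" using assms by auto
  then show "bij (\<lambda>p. cnj z *\<^sub>C T p)"
    using bij_comp[OF bij bij_cscale[of "cnj z"]] by (simp add: o_def)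
  have "z * cnj z = 1" "cnj z * z = 1"
    using assms by (simp_all add: complex_norm_square[symmetric] mult.commute)
  then show "cinner (cnj z *\<^sub>C T p) (Jop (cnj z *\<^sub>C T q)) = cinner p (Jop q)" for p q
    by (simp add: clinear_cscale[OF clinear_Jop] cinner_simps form mult.assoc[symmetric])
qed

lemma fredholm_rotate_iff:
  assumes z: "cmod z = 1"
  shows "fredholm (\<lambda>p. T p - z *\<^sub>C p) \<longleftrightarrow>
    fredholm (\<lambda>p. Vop (\<lambda>p. cnj z *\<^sub>C T p) p - 1 *\<^sub>C p)"
proof -
  interpret R: J_form "\<lambda>p. cnj z *\<^sub>C T p" by (rule J_form_rotate[OF z])
  interpret V: unitary_op "Vop (\<lambda>p. cnj z *\<^sub>C T p)" "inv (Vop (\<lambda>p. cnj z *\<^sub>C T p))" by (rule R.unitary_Vop)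
  define A where "A = (\<lambda>p. T p - z *\<^sub>C p)"
  define B where "B = (\<lambda>p. Vop (\<lambda>p. cnj z *\<^sub>C T p) p - 1 *\<^sub>C p)"
  \<comment> \<open>\<open>T - z\<close> is \<open>z\<close> times the rotated operator minus the
    identity, so the correspondence of ranges under \<open>Jop\<close> acquires a factor
    \<open>cnj z\<close>; \<open>W'\<close> is the inverse.\<close>
  define W where "W = (\<lambda>p::'h \<times> 'h. Jop (cnj z *\<^sub>C p))"
  define W' where "W' = (\<lambda>p::'h \<times> 'h. z *\<^sub>C Jop p)"
  have zz: "z * cnj z = 1" "cnj z * z = 1" using z by (simp_all add: complex_norm_square[symmetric] mult.commute)
  have WW: "W (W' p) = p" "W' (W p) = p" for p by (simp_all add: W_def W'_def zz flip: clinear_cscale[OF clinear_Jop])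
  have cb: "cbounded W" "cbounded W'" "cbounded A" "cbounded B"
    unfolding W_def W'_def A_def B_def
    by (rule cbounded_compose[OF cbounded_Jop cbounded_cscale] cbounded_scaled[OF cbounded_Jop]
        cbounded_diff[OF bounded cbounded_cscale] cbounded_diff[OF normal_pairD(1)[OF V.normal] cbounded_cscale])+
  have rot: "cnj z *\<^sub>C T p - p = cnj z *\<^sub>C A p" for p by (simp add: A_def cscale_diff_right zz)
  have rot': "A p = z *\<^sub>C (cnj z *\<^sub>C T p - p)" for p by (simp add: A_def cscale_diff_right zz)
  have ker: "A p = 0 \<longleftrightarrow> B p = 0" for p
    using R.fixed_iff[of p] unfolding rot B_def[symmetric] by (metis B_def rot rot' cscale_zero_right)
  have ran: "y \<in> range A \<longleftrightarrow> W y \<in> range B" for y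
  proof -
    have "y \<in> range A \<longleftrightarrow> cnj z *\<^sub>C y \<in> range (\<lambda>p. cnj z *\<^sub>C T p - p)"
    proof
      assume "cnj z *\<^sub>C y \<in> range (\<lambda>p. cnj z *\<^sub>C T p - p)"
      then obtain p where p: "cnj z *\<^sub>C y = cnj z *\<^sub>C T p - p" by blast
      have "A p = z *\<^sub>C (cnj z *\<^sub>C y)" unfolding rot' p ..
      then have "y = A p" by (simp add: zz)
      then show "y \<in> range A" by blast
    qed (auto simp: rot)
    then show ?thesis unfolding R.range_iff W_def B_def .
  qed
  have "W' y \<in> range A \<longleftrightarrow> y \<in> range B" for y by (simp add: ran WW)
  then have "fredholm A \<longleftrightarrow> fredholm B"
    using fredholm_transfer[OF cb(3,1,2) WW ker ran] fredholm_transfer[OF cb(4,2,1) WW(2,1), of A] ker by blast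
  then show ?thesis unfolding A_def B_def .
qed

text \<open>In matrix form the right side is \<open>diag(cnj z, 1) V diag(1, z)\<close>:
  \<open>z\<close> enters only through unitary diagonal factors around the fixed
  \<open>Vop T\<close>.\<close>

lemma Vop_rotate:
  assumes z: "cmod z = 1"
  shows "Vop (\<lambda>p. cnj z *\<^sub>C T p) q
    = (cnj z *\<^sub>C fst (Vop T (fst q, z *\<^sub>C snd q)), snd (Vop T (fst q, z *\<^sub>C snd q)))"
proof -
  interpret R: J_form "\<lambda>p. cnj z *\<^sub>C T p" by (rule J_form_rotate[OF z])
  have zz: "z * cnj z = 1" using z by (simp add: complex_norm_square[symmetric])
  obtain p where p: "q = R.in_map p" using R.surj_in_map by blast
  then have "(fst q, z *\<^sub>C snd q) = in_map p" by (simp add: in_map_def R.in_map_def fst_cscale snd_cscale zz)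
  moreover have "Vop (\<lambda>p. cnj z *\<^sub>C T p) q = R.out_map p" by (simp add: p R.Vop_in_map)
  ultimately show ?thesis by (simp add: Vop_in_map R.out_map_def out_map_def fst_cscale)
qed

text \<open>Each of the two diagonal factors contributes \<open>cmod (z - w)\<close>, hence the
  constant \<open>2\<close>.\<close>

lemma Vop_rotate_Lipschitz:
  assumes z: "cmod z = 1" and w: "cmod w = 1"
  shows "norm (Vop (\<lambda>p. cnj z *\<^sub>C T p) q - Vop (\<lambda>p. cnj w *\<^sub>C T p) q) \<le> 2 * cmod (z - w) * norm q"
proof -
  define p where "p = Vop T (fst q, z *\<^sub>C snd q)"
  define r where "r = Vop T (fst q, w *\<^sub>C snd q)"
  have "p - r = Vop T (0, (z - w) *\<^sub>C snd q)"
    by (simp add: p_def r_def clinear_diff[OF clinear_Vop, symmetric] cscale_diff_left)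
  then have "norm (p - r) = cmod (z - w) * norm (snd q)" by (simp add: norm_Vop norm_Pair)
  also have "\<dots> \<le> cmod (z - w) * norm q" using norm_snd_le[of "snd q" "fst q"] by (intro mult_left_mono) auto
  finally have 1: "norm (p - r) \<le> cmod (z - w) * norm q" .
  have "norm p = norm (fst q, z *\<^sub>C snd q)" unfolding p_def by (rule norm_Vop)
  also have "\<dots> = norm q" using z by (cases q) (simp add: norm_Pair)
  finally have "norm p = norm q" .
  then have 2: "norm (fst p) \<le> norm q" using norm_fst_le[of "fst p" "snd p"] by simp
  \<comment> \<open>Telescoping: the first summand accounts for the change of the right factor, the
    second for that of the left one.\<close>
  have eq: "Vop (\<lambda>p. cnj z *\<^sub>C T p) q - Vop (\<lambda>p. cnj w *\<^sub>C T p) q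
    = (cnj w *\<^sub>C fst (p - r), snd (p - r)) + ((cnj (z - w)) *\<^sub>C fst p, 0)"
    unfolding Vop_rotate[OF z] Vop_rotate[OF w] p_def[symmetric] r_def[symmetric]
    by (simp add: cscale_diff_left cscale_diff_right)
  have "norm (cnj w *\<^sub>C fst (p - r), snd (p - r)) = norm (p - r)"
    using w by (simp add: norm_Pair norm_prod_def)
  moreover have "norm ((cnj (z - w)) *\<^sub>C fst p, 0 :: 'h) \<le> cmod (z - w) * norm q"
    using 2 by (simp add: norm_Pair mult_left_mono flip: complex_cnj_diff)
  ultimately show ?thesis
    unfolding eq using 1 norm_triangle_ineq[of "(cnj w *\<^sub>C fst (p - r), snd (p - r))" "((cnj (z - w)) *\<^sub>C fst p, 0)"]
    by linarith
qed

end

lemma J_unitary_J_form: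
  assumes "J_unitary T"
  shows "J_form T"
proof
  show b: "cbounded T" and "bij T" using assms by (auto simp: J_unitary_def)
  show "cinner (T p) (Jop (T q)) = cinner p (Jop q)" for p q
  proof -
    have "adjoint T (Jop (T q)) = Jop q" using assms unfolding J_unitary_def by (metis comp_apply)
    then show ?thesis by (metis cinner_adjoint_left[OF b] cinner_commute)
  qed
qed

text \<open>The maximum is expressed by a common bound \<open>m < 1\<close>, which also makes sense
  where an essential spectrum is empty. \<open>Re\<close> is harmless, as the spectrum of
  \<open>ReOp\<close> of a unitary is real.\<close>

theorem theorem4p4:
  fixes T :: "'h::complex_hilbert \<times> 'h \<Rightarrow> 'h \<times> 'h"
  assumes separable: "\<exists>D::'h set. countable D \<and> closure D = UNIV"
    and JU: "J_unitary T"
  shows "(\<forall>z. cmod z = 1 \<longrightarrow>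
            (fredholm (\<lambda>p. T p - z *\<^sub>C p) \<longleftrightarrow>
               1 \<notin> ess_spectrum (Vop (\<lambda>p. cnj z *\<^sub>C T p)))
          \<and> (fredholm (\<lambda>p. T p - z *\<^sub>C p) \<longleftrightarrow>
               (\<forall>\<mu>\<in>ess_spectrum (ReOp (Vop (\<lambda>p. cnj z *\<^sub>C T p))). Re \<mu> < 1)))
      \<and> (S1_fredholm T \<longleftrightarrow>
           (\<exists>m<1. \<forall>z. cmod z = 1 \<longrightarrow>
              (\<forall>\<mu>\<in>ess_spectrum (ReOp (Vop (\<lambda>p. cnj z *\<^sub>C T p))). Re \<mu> \<le> m)))"
proof -
  interpret J_form T by (rule J_unitary_J_form[OF JU])
  let ?V = "\<lambda>z. Vop (\<lambda>p. cnj z *\<^sub>C T p)"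
  have U: "unitary_op (?V z) (inv (?V z))" if "cmod z = 1" for z
    by (rule J_form.unitary_Vop[OF J_form_rotate[OF that]])
  have part1: "(fredholm (\<lambda>p. T p - z *\<^sub>C p) \<longleftrightarrow> 1 \<notin> ess_spectrum (?V z))
      \<and> (fredholm (\<lambda>p. T p - z *\<^sub>C p) \<longleftrightarrow> (\<forall>\<mu>\<in>ess_spectrum (ReOp (?V z)). Re \<mu> < 1))"
    if "cmod z = 1" for z
    using fredholm_rotate_iff[OF that] unitary_op.fredholm_iff_gapped[OF U[OF that]]
      unitary_op.not_ess_spectrum_iff_gapped[OF U[OF that]]
      unitary_op.ess_spectrum_ReOp_less_iff_gapped[OF U[OF that]] by blast
  have "\<exists>m<1. \<forall>z. cmod z = 1 \<longrightarrow> (\<forall>\<mu>\<in>ess_spectrum (ReOp (?V z)). Re \<mu> \<le> m)"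
    if S1: "S1_fredholm T"
  proof -
    have local_bound: "\<exists>m e. m < 1 \<and> e > 0 \<and> (\<forall>z\<in>ball w e. cmod z = 1 \<longrightarrow>
        (\<forall>\<mu>\<in>ess_spectrum (ReOp (?V z)). Re \<mu> \<le> m))" if w: "cmod w = 1" for w
    proof -
      have "unitary_op.gapped (?V w)"
        using S1 w fredholm_rotate_iff[OF w] unitary_op.fredholm_iff_gapped[OF U[OF w]]
        by (simp add: S1_fredholm_def)
      then obtain F m where F: "finite F" and m: "m < 1"
        and le: "\<And>x. (\<And>v. v \<in> F \<Longrightarrow> cinner v x = 0) \<Longrightarrow> Re (cinner x (?V w x)) \<le> m * (norm x)\<^sup>2"
        using unitary_op.gapped_imp_form_bound[OF U[OF w]] by blast
      \<comment> \<open>With Lipschitz constant \<open>2\<close>, radius \<open>e\<close> raises the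
        bound by at most \<open>2 * e\<close>, which is half the distance from \<open>m\<close> to
        \<open>1\<close>.\<close>
      define e where "e = (1 - m) / 4"
      have e: "e > 0" "m + 2 * e < 1" using m by (auto simp: e_def field_simps)
      have "Re \<mu> \<le> m + 2 * e" if z: "z \<in> ball w e" "cmod z = 1" and \<mu>: "\<mu> \<in> ess_spectrum (ReOp (?V z))" for z \<mu>
      proof (rule unitary_op.ess_spectrum_ReOp_le[OF U[OF z(2)] F _ \<mu>])
        fix x assume x: "\<And>v. v \<in> F \<Longrightarrow> cinner v x = 0"
        have "Re (cinner x (?V z x)) = Re (cinner x (?V w x)) + Re (cinner x (?V z x - ?V w x))"
          by (simp add: cinner_diff_right)
        also have "Re (cinner x (?V z x - ?V w x)) \<le> norm x * norm (?V z x - ?V w x)"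
          using Re_cinner_le_norm by (rule order_trans[OF abs_ge_self])
        also have "\<dots> \<le> norm x * (2 * cmod (z - w) * norm x)"
          by (intro mult_left_mono Vop_rotate_Lipschitz z w) simp
        also have "\<dots> = 2 * cmod (z - w) * (norm x)\<^sup>2" by (simp add: power2_eq_square)
        also have "\<dots> \<le> 2 * e * (norm x)\<^sup>2"
          using z(1) by (intro mult_right_mono) (auto simp: dist_norm norm_minus_commute)
        finally show "Re (cinner x (?V z x)) \<le> (m + 2 * e) * (norm x)\<^sup>2"
          using le[of x] x by (simp add: distrib_right)
      qed
      with e show ?thesis by blast
    qed
    then obtain m e where me: "\<And>w. cmod w = 1 \<Longrightarrow> m w < (1::real)" "\<And>w. cmod w = 1 \<Longrightarrow> e w > (0::real)"
      "\<And>w z \<mu>. cmod w = 1 \<Longrightarrow> z \<in> ball w (e w) \<Longrightarrow> cmod z = 1 \<Longrightarrow> \<mu> \<in> ess_spectrum (ReOp (?V z)) \<Longrightarrow> Re \<mu> \<le> m w"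
      by metis
    have "sphere 0 1 \<subseteq> (\<Union>w\<in>sphere 0 1. ball w (e w))" using me(2) by force
    then obtain D where D: "D \<subseteq> sphere (0::complex) 1" "finite D" "sphere 0 1 \<subseteq> (\<Union>w\<in>D. ball w (e w))"
      using compactE_image[OF compact_sphere, of "sphere 0 1" "\<lambda>w. ball w (e w)" 0 1] by blast
    \<comment> \<open>The circle is nonempty, so the finite subcover is too and \<open>Max\<close>
      is meaningful.\<close>
    have "(1::complex) \<in> sphere 0 1" by simp
    then have ne: "D \<noteq> {}" using D(3) by blast
    have "Max (m ` D) < 1" using D ne me(1) by (auto simp: subset_iff)
    moreover have "Re \<mu> \<le> Max (m ` D)" if z: "cmod z = 1" and \<mu>: "\<mu> \<in> ess_spectrum (ReOp (?V z))" for z \<mu>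
    proof -
      have "z \<in> sphere 0 1" using z by simp
      then obtain w where w: "w \<in> D" "z \<in> ball w (e w)" using D(3) by blast
      then have "Re \<mu> \<le> m w" using D(1) z \<mu> by (intro me(3)) auto
      also have "m w \<le> Max (m ` D)" using w D(2) by simp
      finally show ?thesis .
    qed
    ultimately show ?thesis by blast
  qed
  moreover have "S1_fredholm T"
    if "\<exists>m<1. \<forall>z. cmod z = 1 \<longrightarrow> (\<forall>\<mu>\<in>ess_spectrum (ReOp (?V z)). Re \<mu> \<le> m)"
    unfolding S1_fredholm_def
  proof (intro allI impI)
    fix z :: complex assume z: "cmod z = 1"
    with that have "\<forall>\<mu>\<in>ess_spectrum (ReOp (?V z)). Re \<mu> < 1" by (meson le_less_trans)
    with part1[OF z] show "fredholm (\<lambda>p. T p - z *\<^sub>C p)" by blast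
  qed
  ultimately show ?thesis using part1 by blast
qed

end
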